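(* Let $n\ge 2$. For $q=(q_1,\dots,q_n)$ with all $q_i>0$, let $\mathcal{R}(q)=V_{n-1}(\partial E_q)/V_n(E_q)$ be the ratio of the surface area to the volume of the ellipsoid $E_q$ whose semi-axes have lengths $1/q_1,\dots,1/q_n$. Then $\mathcal{R}$ is a norm on the vectors $q$ of inverse semi-axes; that is, there is a norm $N$ on $\mathbb{R}^n$ such that $N(q)=\mathcal{R}(q)$ for every $q\in(0,\infty)^n$.
   Context: $E_q=\{x\in\mathbb{R}^n : \sum_{i=1}^n q_i^2x_i^2\le 1\}$. $V_n(E_q)$ is the $n$-dimensional volume of $E_q$ and $V_{n-1}(\partial E_q)$ is the surface area of its boundary. *)

theory Defs
  imports "HOL-Analysis.Analysis"
begin

text \<open>
  The \<open>k\<close>-dimensional Hausdorff (outer) measure, normalised by the volume of the unit ball of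
  dimension \<open>k\<close>, so that it agrees with Lebesgue measure on \<open>k\<close>-dimensional Euclidean space.
  The empty set is treated separately so that it contributes nothing also for \<open>k = 0\<close>;
  boundedness is required because \<^const>\<open>diameter\<close> is only meaningful for bounded sets.
\<close>

definition hausdorff_measure :: "nat \<Rightarrow> 'a::metric_space set \<Rightarrow> ennreal" where
  "hausdorff_measure k A =
     (SUP \<delta>\<in>{0::real<..}.
        INF C\<in>{C :: nat \<Rightarrow> 'a set. A \<subseteq> (\<Union>i. C i) \<and> (\<forall>i. bounded (C i) \<and> diameter (C i) \<le> \<delta>)}.
          (\<Sum>i. if C i = {} then 0
               else ennreal (unit_ball_vol (real k) * (diameter (C i) / 2) ^ k)))"

definition ellipsoid :: "real ^ 'n \<Rightarrow> (real ^ 'n) set" where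
  "ellipsoid q = {x. (\<Sum>i\<in>UNIV. (q $ i)\<^sup>2 * (x $ i)\<^sup>2) \<le> 1}"

definition surface_volume_ratio :: "real ^ 'n \<Rightarrow> ennreal" where
  "surface_volume_ratio q =
     hausdorff_measure (CARD('n) - 1) (frontier (ellipsoid q)) / emeasure lborel (ellipsoid q)"

definition is_norm :: "('a::real_vector \<Rightarrow> real) \<Rightarrow> bool" where
  "is_norm N \<longleftrightarrow>
     (\<forall>x. N x \<ge> 0) \<and>
     (\<forall>x. N x = 0 \<longleftrightarrow> x = 0) \<and>
     (\<forall>a x. N (a *\<^sub>R x) = \<bar>a\<bar> * N x) \<and>
     (\<forall>x y. N (x + y) \<le> N x + N y)"

end

theory Submission
  imports Defs
begin

text \<open>
  Write \<open>D\<close> for the diagonal map with entries \<open>q\<^sub>i\<close>, so that the ellipsoid is \<open>|D x| \<le> 1\<close>. The vector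
  \<open>w = D (D p)\<close> is normal to the surface at a surface point \<open>p\<close>, and the tangent plane there is
  \<open>{y. y \<bullet> w = 1}\<close>, at distance \<open>1 / |w|\<close> from the origin. The cone from the origin over a flat
  piece \<open>B\<close> of that plane has volume equal to a constant times the area of \<open>B\<close> divided by \<open>|w|\<close>.
  Cutting the ellipsoid into thin cones over small surface pieces therefore expresses the surface
  area as \<open>\<kappa>\<close> times the integral of \<open>|D (D (x / |D x|))|\<close> over the solid ellipsoid, where \<open>\<kappa>\<close> depends
  only on the dimension. The substitution \<open>x = D\<inverse> y\<close> multiplies this integral and the volume of the
  ellipsoid by the same determinant, so that
  \<open>surface / volume = \<kappa> / \<omega>\<^sub>n * (\<integral> |D (y / |y|)| dy over the unit ball)\<close>, where \<open>\<omega>\<^sub>n\<close> is the volume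
  of the unit ball. For each fixed \<open>y\<close> the integrand is a seminorm of \<open>q\<close>, and the right-hand side
  makes sense for every \<open>q\<close>; it vanishes only for \<open>q = 0\<close>, and so it is the required norm.

  The work lies in deriving the cone formula for the Hausdorff measure. On a space of dimension \<open>k\<close>,
  the \<open>k\<close>-dimensional Hausdorff measure is a constant multiple of Lebesgue measure on bounded Borel
  sets. This rests on a general uniqueness statement (\<open>uniqueness_of_affine_scaling_measure\<close>),
  which also shows that linear isometries between different Euclidean spaces of equal dimension
  preserve Lebesgue measure. Slicing a cone into homothetic copies of its base then gives
  \<open>hausdorff_measure_flat\<close>. For curved pieces, the central projection of the surface to a tangent
  plane is a bi-Lipschitz map whose constants tend to 1 as the pieces shrink, uniformly over the surface
  (\<open>flattening_distortion\<close>), so that on small pieces Hausdorff measure and weighted cone volume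
  agree up to a factor \<open>\<rho>\<close> close to 1 (\<open>hausdorff_measure_small_piece\<close>). Finally
  \<open>hausdorff_measure_eq_if_locally_comparable\<close> sums over a finite partition: subadditivity gives
  one inequality, and for the other the pieces are replaced by compact subsets of almost full
  measure, on which the Hausdorff measure is additive because they lie at positive distance.
\<close>

section \<open>Hausdorff measure as a metric outer measure\<close>

text \<open>
  The Hausdorff measure is taken apart into the contribution of a single covering set, the
  admissible coverings, and the infimum at a fixed scale, because subadditivity, Lipschitz images and
  additivity on separated sets are all proved at a fixed scale first.
\<close>

definition diam_content :: "nat \<Rightarrow> 'a::metric_space set \<Rightarrow> ennreal" where
  "diam_content k C =
     (if C = {} then 0 else ennreal (unit_ball_vol (real k) * (diameter C / 2) ^ k))"

definition fine_covers :: "real \<Rightarrow> 'a::metric_space set \<Rightarrow> (nat \<Rightarrow> 'a set) set" where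
  "fine_covers \<delta> A = {C. A \<subseteq> (\<Union>i. C i) \<and> (\<forall>i. bounded (C i) \<and> diameter (C i) \<le> \<delta>)}"

definition hausdorff_pre :: "nat \<Rightarrow> real \<Rightarrow> 'a::metric_space set \<Rightarrow> ennreal" where
  "hausdorff_pre k \<delta> A = (INF C\<in>fine_covers \<delta> A. \<Sum>i. diam_content k (C i))"

lemma hausdorff_measure_eq_SUP: "hausdorff_measure k A = (SUP \<delta>\<in>{0<..}. hausdorff_pre k \<delta> A)"
  by (simp add: hausdorff_measure_def hausdorff_pre_def diam_content_def fine_covers_def)

lemma diam_content_empty [simp]: "diam_content k {} = 0"
  by (simp add: diam_content_def)

lemma fine_coversI:
  "A \<subseteq> (\<Union>i. C i) \<Longrightarrow> (\<And>i. bounded (C i)) \<Longrightarrow> (\<And>i. diameter (C i) \<le> \<delta>) \<Longrightarrow> C \<in> fine_covers \<delta> A"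
  by (auto simp: fine_covers_def)

lemma fine_coversD:
  assumes "C \<in> fine_covers \<delta> A"
  shows "A \<subseteq> (\<Union>i. C i)" "bounded (C i)" "diameter (C i) \<le> \<delta>"
  using assms by (auto simp: fine_covers_def)

lemma hausdorff_pre_le: "C \<in> fine_covers \<delta> A \<Longrightarrow> hausdorff_pre k \<delta> A \<le> (\<Sum>i. diam_content k (C i))"
  unfolding hausdorff_pre_def by (rule INF_lower)

lemma hausdorff_pre_greatest:
  "(\<And>C. C \<in> fine_covers \<delta> A \<Longrightarrow> z \<le> (\<Sum>i. diam_content k (C i))) \<Longrightarrow> z \<le> hausdorff_pre k \<delta> A"
  unfolding hausdorff_pre_def by (rule INF_greatest)

lemma hausdorff_pre_le_measure: "0 < \<delta> \<Longrightarrow> hausdorff_pre k \<delta> A \<le> hausdorff_measure k A"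
  unfolding hausdorff_measure_eq_SUP by (rule SUP_upper) simp

lemma hausdorff_measure_least:
  "(\<And>\<delta>. 0 < \<delta> \<Longrightarrow> hausdorff_pre k \<delta> A \<le> z) \<Longrightarrow> hausdorff_measure k A \<le> z"
  unfolding hausdorff_measure_eq_SUP by (rule SUP_least) simp

lemma hausdorff_pre_mono: "A \<subseteq> B \<Longrightarrow> hausdorff_pre k \<delta> A \<le> hausdorff_pre k \<delta> B"
  by (rule hausdorff_pre_greatest, rule hausdorff_pre_le) (auto simp: fine_covers_def)

lemma hausdorff_pre_antimono: "\<delta> \<le> \<delta>' \<Longrightarrow> hausdorff_pre k \<delta>' A \<le> hausdorff_pre k \<delta> A"
  by (rule hausdorff_pre_greatest, rule hausdorff_pre_le) (auto simp: fine_covers_def intro: order_trans)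

lemma hausdorff_measure_mono: "A \<subseteq> B \<Longrightarrow> hausdorff_measure k A \<le> hausdorff_measure k B"
  by (rule hausdorff_measure_least)
     (rule order_trans[OF hausdorff_pre_mono hausdorff_pre_le_measure])

lemma hausdorff_pre_le_diam_content:
  assumes "bounded A" "diameter A \<le> \<delta>" "0 \<le> \<delta>"
  shows "hausdorff_pre k \<delta> A \<le> diam_content k A"
proof -
  define C where "C n = (if n = 0 then A else {})" for n :: nat
  have "C \<in> fine_covers \<delta> A"
    using assms by (intro fine_coversI) (auto simp: C_def)
  then have "hausdorff_pre k \<delta> A \<le> (\<Sum>n. diam_content k (C n))"
    by (rule hausdorff_pre_le)
  also have "\<dots> = (\<Sum>n\<in>{0}. diam_content k (C n))"
    by (rule suminf_finite) (auto simp: C_def)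
  finally show ?thesis by (simp add: C_def)
qed

lemma hausdorff_pre_empty: "0 \<le> \<delta> \<Longrightarrow> hausdorff_pre k \<delta> {} = 0"
  using hausdorff_pre_le_diam_content[of "{}" \<delta> k] by simp

lemma hausdorff_measure_empty [simp]: "hausdorff_measure k {} = 0"
  using hausdorff_measure_least[of k "{}" 0] by (simp add: hausdorff_pre_empty)

lemma hausdorff_pre_countably_subadditive:
  "hausdorff_pre k \<delta> (\<Union>i. A i) \<le> (\<Sum>i::nat. hausdorff_pre k \<delta> (A i))"
proof (cases "\<exists>i. hausdorff_pre k \<delta> (A i) = top")
  case True
  then obtain i where "hausdorff_pre k \<delta> (A i) = top" by blast
  moreover have "hausdorff_pre k \<delta> (A i) \<le> (\<Sum>i. hausdorff_pre k \<delta> (A i))"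
    using sum_le_suminf[of "\<lambda>i. hausdorff_pre k \<delta> (A i)" "{i}"] by simp
  ultimately show ?thesis by (simp add: top_unique)
next
  case False
  show ?thesis
  proof (rule ennreal_le_epsilon)
    fix e :: real assume e: "0 < e"
    \<comment> \<open>Coverings of the single sets with errors that sum to \<open>e\<close> are merged along a bijection
       between pairs and natural numbers.\<close>
    have "\<exists>C\<in>fine_covers \<delta> (A i). (\<Sum>j. diam_content k (C j)) < hausdorff_pre k \<delta> (A i) + ennreal (e * (1/2) ^ Suc i)" for i
    proof -
      have "hausdorff_pre k \<delta> (A i) < hausdorff_pre k \<delta> (A i) + ennreal (e * (1/2) ^ Suc i)"
        using False e ennreal_add_left_cancel_less[of "hausdorff_pre k \<delta> (A i)" 0] by auto
      then show ?thesis
        unfolding hausdorff_pre_def by (simp add: INF_less_iff)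
    qed
    then obtain C where C: "\<And>i. C i \<in> fine_covers \<delta> (A i)"
      "\<And>i. (\<Sum>j. diam_content k (C i j)) < hausdorff_pre k \<delta> (A i) + ennreal (e * (1/2) ^ Suc i)"
      by metis
    define D where "D = (\<lambda>n. case prod_decode n of (i, j) \<Rightarrow> C i j)"
    have D: "D \<in> fine_covers \<delta> (\<Union>i. A i)"
    proof (rule fine_coversI)
      show "(\<Union>i. A i) \<subseteq> (\<Union>n. D n)"
      proof
        fix x assume "x \<in> (\<Union>i. A i)"
        then obtain i j where "x \<in> C i j" using fine_coversD(1)[OF C(1)] by blast
        then have "x \<in> D (prod_encode (i, j))" by (simp add: D_def)
        then show "x \<in> (\<Union>n. D n)" by blast
      qed
    qed (use fine_coversD[OF C(1)] in \<open>auto simp: D_def split: prod.split\<close>)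
    have "hausdorff_pre k \<delta> (\<Union>i. A i) \<le> (\<Sum>n. diam_content k (D n))"
      by (rule hausdorff_pre_le[OF D])
    also have "\<dots> = (\<Sum>n. (\<lambda>(i, j). diam_content k (C i j)) (prod_decode n))"
      by (simp add: D_def case_prod_beta)
    also have "\<dots> = (\<Sum>i. \<Sum>j. diam_content k (C i j))"
      by (rule suminf_ennreal_2dimen) simp
    also have "\<dots> \<le> (\<Sum>i. hausdorff_pre k \<delta> (A i) + ennreal (e * (1/2) ^ Suc i))"
      by (intro suminf_le allI less_imp_le C(2)) auto
    also have "\<dots> = (\<Sum>i. hausdorff_pre k \<delta> (A i)) + (\<Sum>i. ennreal (e * (1/2) ^ Suc i))"
      by (simp add: suminf_add)
    also have "(\<Sum>i. ennreal (e * (1/2) ^ Suc i)) = ennreal e"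
    proof -
      have "(\<lambda>i. e * (1/2) ^ Suc i) sums (e * 1)"
        by (intro sums_mult power_half_series)
      then show ?thesis
        using e by (intro suminf_ennreal_eq) auto
    qed
    finally show "hausdorff_pre k \<delta> (\<Union>i. A i) \<le> (\<Sum>i. hausdorff_pre k \<delta> (A i)) + ennreal e" .
  qed
qed

lemma hausdorff_measure_countably_subadditive:
  "hausdorff_measure k (\<Union>i. A i) \<le> (\<Sum>i::nat. hausdorff_measure k (A i))"
proof (rule hausdorff_measure_least)
  fix \<delta> :: real assume "0 < \<delta>"
  then have "(\<Sum>i. hausdorff_pre k \<delta> (A i)) \<le> (\<Sum>i. hausdorff_measure k (A i))"
    by (intro suminf_le allI hausdorff_pre_le_measure) auto
  then show "hausdorff_pre k \<delta> (\<Union>i. A i) \<le> (\<Sum>i. hausdorff_measure k (A i))"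
    using hausdorff_pre_countably_subadditive order_trans by blast
qed

lemma finite_subadditive_if_countably:
  fixes \<phi> :: "'a set \<Rightarrow> ennreal"
  assumes "finite I" and empty: "\<phi> {} = 0"
    and subadd: "\<And>B :: nat \<Rightarrow> 'a set. \<phi> (\<Union>n. B n) \<le> (\<Sum>n. \<phi> (B n))"
  shows "\<phi> (\<Union>i\<in>I. A i) \<le> (\<Sum>i\<in>I. \<phi> (A i))"
proof -
  obtain f where f: "bij_betw f {..<card I} I"
    using assms ex_bij_betw_nat_finite lessThan_atLeast0 by metis
  define B where "B n = (if n < card I then A (f n) else {})" for n
  have "(\<Union>n. B n) = (\<Union>i\<in>f ` {..<card I}. A i)"
    by (auto simp: B_def split: if_splits)
  also have "\<dots> = (\<Union>i\<in>I. A i)"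
    by (simp only: bij_betw_imp_surj_on[OF f])
  finally have "(\<Union>i\<in>I. A i) = (\<Union>n. B n)" by (rule sym)
  then have "\<phi> (\<Union>i\<in>I. A i) \<le> (\<Sum>n. \<phi> (B n))"
    using subadd by metis
  also have "\<dots> = (\<Sum>n<card I. \<phi> (B n))"
    by (rule suminf_finite) (auto simp: B_def empty)
  also have "\<dots> = (\<Sum>n<card I. \<phi> (A (f n)))"
    by (simp add: B_def)
  also have "\<dots> = (\<Sum>i\<in>I. \<phi> (A i))"
    by (rule sum.reindex_bij_betw[OF f])
  finally show ?thesis .
qed

lemmas hausdorff_measure_finite_subadditive =
  finite_subadditive_if_countably[of _ "hausdorff_measure k" for k,
    OF _ hausdorff_measure_empty hausdorff_measure_countably_subadditive]

text \<open>
  Images under \<open>f\<close> of a covering by sets of diameter at most \<open>\<delta> / L\<close> have diameter at most \<open>\<delta>\<close>, and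
  each contribution grows by at most the factor \<open>L ^ k\<close>.
\<close>

lemma hausdorff_measure_lipschitz_image:
  fixes f :: "'a::metric_space \<Rightarrow> 'b::metric_space"
  assumes L: "0 < L" and f: "\<And>x y. x \<in> A \<Longrightarrow> y \<in> A \<Longrightarrow> dist (f x) (f y) \<le> L * dist x y"
  shows "hausdorff_measure k (f ` A) \<le> ennreal (L ^ k) * hausdorff_measure k A"
proof (rule hausdorff_measure_least)
  fix \<delta> :: real assume \<delta>: "0 < \<delta>"
  have Lk: "ennreal (L ^ k) * ennreal (1 / L ^ k) = 1"
    using L by (simp flip: ennreal_mult)
  have step: "hausdorff_pre k \<delta> (f ` A) \<le> ennreal (L ^ k) * (\<Sum>i. diam_content k (C i))"
    if C: "C \<in> fine_covers (\<delta> / L) A" for C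
  proof -
    define D where "D i = f ` (C i \<inter> A)" for i
    note C' = fine_coversD[OF C]
    have dist_D: "dist x y \<le> L * diameter (C i)" if "x \<in> D i" "y \<in> D i" for x y i
    proof -
      obtain u v where uv: "x = f u" "y = f v" "u \<in> C i" "v \<in> C i" "u \<in> A" "v \<in> A"
        using \<open>x \<in> D i\<close> \<open>y \<in> D i\<close> by (auto simp: D_def)
      then have "dist x y \<le> L * dist u v" using f by simp
      also have "\<dots> \<le> L * diameter (C i)"
        using L C'(2) uv by (intro mult_left_mono diameter_bounded_bound) auto
      finally show ?thesis .
    qed
    have diam_D: "diameter (D i) \<le> L * diameter (C i)" for i
    proof (cases "D i = {}")
      case True
      then show ?thesis using L C'(2)[of i] by (simp add: diameter_ge_0)
    next
      case False
      then have "(SUP (x, y)\<in>D i \<times> D i. dist x y) \<le> L * diameter (C i)"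
        using dist_D by (intro cSUP_least) auto
      then show ?thesis
        using False by (simp add: diameter_def[of "D i"])
    qed
    have bdd_D: "bounded (D i)" for i
      unfolding bounded_two_points using dist_D by blast
    have "D \<in> fine_covers \<delta> (f ` A)"
    proof (rule fine_coversI)
      show "f ` A \<subseteq> (\<Union>i. D i)" using C'(1) by (fastforce simp: D_def)
      show "diameter (D i) \<le> \<delta>" for i
        using diam_D[of i] mult_left_mono[OF C'(3)[of i], of L] L by simp
    qed (rule bdd_D)
    then have "hausdorff_pre k \<delta> (f ` A) \<le> (\<Sum>i. diam_content k (D i))"
      by (rule hausdorff_pre_le)
    also have "\<dots> \<le> (\<Sum>i. ennreal (L ^ k) * diam_content k (C i))"
    proof (intro suminf_le allI)
      fix i
      show "diam_content k (D i) \<le> ennreal (L ^ k) * diam_content k (C i)"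
      proof (cases "D i = {}")
        case False
        then have "C i \<noteq> {}" by (auto simp: D_def)
        have "(diameter (D i) / 2) ^ k \<le> (L * (diameter (C i) / 2)) ^ k"
          using diam_D[of i] diameter_ge_0[OF bdd_D[of i]] by (intro power_mono) auto
        then have "unit_ball_vol (real k) * (diameter (D i) / 2) ^ k
            \<le> L ^ k * (unit_ball_vol (real k) * (diameter (C i) / 2) ^ k)"
          using mult_left_mono[of "(diameter (D i) / 2) ^ k" "(L * (diameter (C i) / 2)) ^ k" "unit_ball_vol (real k)"]
          by (simp only: power_mult_distrib mult.left_commute) simp
        then show ?thesis
          unfolding diam_content_def using False \<open>C i \<noteq> {}\<close> L
          by (simp only: if_False ennreal_mult'[symmetric] zero_le_power less_imp_le ennreal_leI)
      qed simp
    qed auto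
    finally show ?thesis by simp
  qed
  \<comment> \<open>The factor is moved to the left so that the infimum over coverings can be taken on the right.\<close>
  have "ennreal (1 / L ^ k) * hausdorff_pre k \<delta> (f ` A) \<le> hausdorff_pre k (\<delta> / L) A"
  proof (rule hausdorff_pre_greatest)
    fix C assume "C \<in> fine_covers (\<delta> / L) A"
    then have "ennreal (1 / L ^ k) * hausdorff_pre k \<delta> (f ` A)
        \<le> ennreal (1 / L ^ k) * (ennreal (L ^ k) * (\<Sum>i. diam_content k (C i)))"
      by (intro mult_left_mono step) auto
    also have "\<dots> = (ennreal (L ^ k) * ennreal (1 / L ^ k)) * (\<Sum>i. diam_content k (C i))"
      by (simp only: mult_ac)
    also have "\<dots> = (\<Sum>i. diam_content k (C i))"
      by (simp only: Lk mult_1)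
    finally show "ennreal (1 / L ^ k) * hausdorff_pre k \<delta> (f ` A) \<le> (\<Sum>i. diam_content k (C i))" .
  qed
  also have "\<dots> \<le> hausdorff_measure k A"
    using \<delta> L by (intro hausdorff_pre_le_measure) auto
  finally have "ennreal (L ^ k) * (ennreal (1 / L ^ k) * hausdorff_pre k \<delta> (f ` A))
      \<le> ennreal (L ^ k) * hausdorff_measure k A"
    by (intro mult_left_mono) auto
  then show "hausdorff_pre k \<delta> (f ` A) \<le> ennreal (L ^ k) * hausdorff_measure k A"
    by (simp only: Lk mult_1 mult.assoc[symmetric])
qed

lemma hausdorff_measure_affine_image:
  fixes A :: "'a::real_normed_vector set"
  assumes s: "0 < s"
  shows "hausdorff_measure k ((\<lambda>x. a + s *\<^sub>R x) ` A) = ennreal (s ^ k) * hausdorff_measure k A"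
proof (rule antisym)
  show "hausdorff_measure k ((\<lambda>x. a + s *\<^sub>R x) ` A) \<le> ennreal (s ^ k) * hausdorff_measure k A"
    using s by (intro hausdorff_measure_lipschitz_image) (auto simp: dist_norm simp flip: scaleR_diff_right)
  let ?T = "(\<lambda>x. a + s *\<^sub>R x) ` A"
  have "A = (\<lambda>y. (1 / s) *\<^sub>R (y - a)) ` ?T"
    using s by (simp add: image_image)
  then have "hausdorff_measure k A = hausdorff_measure k ((\<lambda>y. (1 / s) *\<^sub>R (y - a)) ` ?T)"
    by simp
  also have "\<dots> \<le> ennreal ((1 / s) ^ k) * hausdorff_measure k ?T"
    using s by (intro hausdorff_measure_lipschitz_image) (auto simp: dist_norm simp flip: scaleR_diff_right)
  finally have "ennreal (s ^ k) * hausdorff_measure k A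
      \<le> ennreal (s ^ k) * (ennreal ((1 / s) ^ k) * hausdorff_measure k ?T)"
    by (intro mult_left_mono) auto
  also have "\<dots> = hausdorff_measure k ?T"
    using s by (simp add: mult.assoc[symmetric] power_one_over flip: ennreal_mult)
  finally show "ennreal (s ^ k) * hausdorff_measure k A \<le> hausdorff_measure k ?T" .
qed

lemma hausdorff_measure_isometric_image:
  fixes f :: "'a::metric_space \<Rightarrow> 'b::metric_space"
  assumes f: "\<And>x y. dist (f x) (f y) = dist x y"
  shows "hausdorff_measure k (f ` A) = hausdorff_measure k A"
proof (rule antisym)
  show "hausdorff_measure k (f ` A) \<le> hausdorff_measure k A"
    using hausdorff_measure_lipschitz_image[of 1 A f k] f by simp
  have "inj f" by (rule injI) (metis f dist_eq_0_iff)
  then have "inv f ` f ` A = A" by (simp add: image_image)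
  moreover have "hausdorff_measure k (inv f ` f ` A) \<le> ennreal (1 ^ k) * hausdorff_measure k (f ` A)"
    by (rule hausdorff_measure_lipschitz_image) (use f \<open>inj f\<close> in auto)
  ultimately show "hausdorff_measure k A \<le> hausdorff_measure k (f ` A)"
    by simp
qed

text \<open>
  A covering set of diameter less than \<open>d\<close> cannot meet both \<open>A\<close> and \<open>B\<close>, so a fine covering of the
  union splits into one covering of \<open>A\<close> and one of \<open>B\<close>. The empty set contributes nothing, which
  allows the sets that miss \<open>A\<close> (or \<open>B\<close>) to be replaced by it.
\<close>

lemma hausdorff_measure_separated_superadditive:
  assumes d: "0 < d" and sep: "\<And>x y. x \<in> A \<Longrightarrow> y \<in> B \<Longrightarrow> d \<le> dist x y"
  shows "hausdorff_measure k A + hausdorff_measure k B \<le> hausdorff_measure k (A \<union> B)"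
proof -
  have pre: "hausdorff_pre k \<delta> A + hausdorff_pre k \<delta> B \<le> hausdorff_pre k \<delta> (A \<union> B)"
    if \<delta>: "0 < \<delta>" "\<delta> < d" for \<delta>
  proof (rule hausdorff_pre_greatest)
    fix C assume C: "C \<in> fine_covers \<delta> (A \<union> B)"
    note C' = fine_coversD[OF C]
    define CA where "CA i = (if C i \<inter> A = {} then {} else C i)" for i
    define CB where "CB i = (if C i \<inter> B = {} then {} else C i)" for i
    have "C i \<inter> A = {} \<or> C i \<inter> B = {}" for i
    proof (rule ccontr)
      assume "\<not> ?thesis"
      then obtain x y where "x \<in> C i" "x \<in> A" "y \<in> C i" "y \<in> B" by blast
      then have "d \<le> diameter (C i)"
        using sep[of x y] diameter_bounded_bound[OF C'(2), of x i y] by linarith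
      then show False using C'(3)[of i] \<delta> by linarith
    qed
    then have "CA i = {} \<and> CB i \<in> {{}, C i} \<or> CB i = {} \<and> CA i \<in> {{}, C i}" for i
      by (auto simp: CA_def CB_def)
    then have split: "diam_content k (CA i) + diam_content k (CB i) \<le> diam_content k (C i)" for i
      
      by (metis add.left_neutral add.right_neutral diam_content_empty order_refl zero_le empty_iff insert_iff)
    have "CA \<in> fine_covers \<delta> A"
    proof (rule fine_coversI)
      show "A \<subseteq> (\<Union>i. CA i)" using C'(1) by (fastforce simp: CA_def)
    qed (use C' \<delta> in \<open>auto simp: CA_def\<close>)
    moreover have "CB \<in> fine_covers \<delta> B"
    proof (rule fine_coversI)
      show "B \<subseteq> (\<Union>i. CB i)" using C'(1) by (fastforce simp: CB_def)
    qed (use C' \<delta> in \<open>auto simp: CB_def\<close>)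
    ultimately have "hausdorff_pre k \<delta> A + hausdorff_pre k \<delta> B
        \<le> (\<Sum>i. diam_content k (CA i)) + (\<Sum>i. diam_content k (CB i))"
      by (intro add_mono hausdorff_pre_le)
    also have "\<dots> = (\<Sum>i. diam_content k (CA i) + diam_content k (CB i))"
      by (simp add: suminf_add)
    also have "\<dots> \<le> (\<Sum>i. diam_content k (C i))"
      by (intro suminf_le allI split) auto
    finally show "hausdorff_pre k \<delta> A + hausdorff_pre k \<delta> B \<le> (\<Sum>i. diam_content k (C i))" .
  qed
  \<comment> \<open>The two suprema run over independent scales; both are compared with a common finer scale.\<close>
  have fin: "hausdorff_pre k \<delta> A + hausdorff_pre k \<delta>' B \<le> hausdorff_measure k (A \<union> B)"
    if "0 < \<delta>" "0 < \<delta>'" for \<delta> \<delta>'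
  proof -
    define \<epsilon> where "\<epsilon> = min (d/2) (min \<delta> \<delta>')"
    have \<epsilon>: "0 < \<epsilon>" "\<epsilon> < d" "\<epsilon> \<le> \<delta>" "\<epsilon> \<le> \<delta>'" using that d by (auto simp: \<epsilon>_def min_def)
    have "hausdorff_pre k \<delta> A + hausdorff_pre k \<delta>' B \<le> hausdorff_pre k \<epsilon> A + hausdorff_pre k \<epsilon> B"
      by (intro add_mono hausdorff_pre_antimono \<epsilon>)
    also have "\<dots> \<le> hausdorff_pre k \<epsilon> (A \<union> B)" by (rule pre[OF \<epsilon>(1,2)])
    also have "\<dots> \<le> hausdorff_measure k (A \<union> B)" by (rule hausdorff_pre_le_measure[OF \<epsilon>(1)])
    finally show ?thesis .
  qed
  have "hausdorff_measure k A + hausdorff_measure k B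
      = (SUP \<delta>\<in>{0<..}. SUP \<delta>'\<in>{0<..}. hausdorff_pre k \<delta> A + hausdorff_pre k \<delta>' B)"
    unfolding hausdorff_measure_eq_SUP
    by (subst ennreal_SUP_add_left[symmetric], simp, subst ennreal_SUP_add_right[symmetric], simp_all)
  also have "\<dots> \<le> hausdorff_measure k (A \<union> B)"
    by (intro SUP_least fin) auto
  finally show ?thesis .
qed

lemma hausdorff_measure_disjoint_compacts:
  fixes K :: "'i \<Rightarrow> 'a::heine_borel set"
  assumes "finite I" "\<And>i. i \<in> I \<Longrightarrow> compact (K i)" "disjoint_family_on K I"
  shows "(\<Sum>i\<in>I. hausdorff_measure k (K i)) \<le> hausdorff_measure k (\<Union>i\<in>I. K i)"
  using assms
proof (induction I rule: finite_induct)
  case (insert i I)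
  have "compact (\<Union>j\<in>I. K j)" using insert by (intro compact_UN) auto
  moreover have "K i \<inter> (\<Union>j\<in>I. K j) = {}"
    using insert.hyps insert.prems(2) by (fastforce simp: disjoint_family_on_def)
  ultimately obtain d where d: "0 < d" "\<forall>x\<in>K i. \<forall>y\<in>(\<Union>j\<in>I. K j). d \<le> dist x y"
    using separate_compact_closed[of "K i" "\<Union>j\<in>I. K j"] insert.prems(1)[of i] compact_imp_closed by blast
  have "(\<Sum>j\<in>I. hausdorff_measure k (K j)) \<le> hausdorff_measure k (\<Union>j\<in>I. K j)"
    using insert.prems by (intro insert.IH) (auto simp: disjoint_family_on_def)
  then have "(\<Sum>j\<in>insert i I. hausdorff_measure k (K j))
      \<le> hausdorff_measure k (K i) + hausdorff_measure k (\<Union>j\<in>I. K j)"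
    using insert.hyps by (simp add: add_left_mono)
  also have "\<dots> \<le> hausdorff_measure k (K i \<union> (\<Union>j\<in>I. K j))"
    using d by (intro hausdorff_measure_separated_superadditive[of d]) auto
  finally show ?case by simp
qed simp

section \<open>Set functions that scale like Lebesgue measure\<close>

lemma affine_image_borel:
  fixes A :: "'a::euclidean_space set"
  assumes [measurable]: "A \<in> sets borel" and s: "s \<noteq> 0"
  shows "(\<lambda>x. a + s *\<^sub>R x) ` A \<in> sets borel"
proof -
  have "(\<lambda>x. a + s *\<^sub>R x) ` A = {y \<in> space borel. (1 / s) *\<^sub>R (y - a) \<in> A}"
    using s by (auto simp: image_iff intro!: bexI[of _ "(1 / s) *\<^sub>R (_ - a)"])
  also have "\<dots> \<in> sets borel" by measurable
  finally show ?thesis .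
qed

lemma emeasure_lborel_affine_image:
  fixes A :: "'a::euclidean_space set"
  assumes A: "A \<in> sets borel" and s: "0 < s"
  shows "emeasure lborel ((\<lambda>x. a + s *\<^sub>R x) ` A) = ennreal (s ^ DIM('a)) * emeasure lborel A"
  using emeasure_lebesgue_affine[of s a A] affine_image_borel[OF A, of s a] A s
  by (simp add: add.commute ennreal_power)

lemma bounded_in_centred_cube:
  fixes B :: "'a::euclidean_space set"
  assumes "bounded B"
  obtains r where "0 < r" "B \<subseteq> cbox (- (r *\<^sub>R One)) (r *\<^sub>R One)"
proof -
  obtain r where r: "0 < r" "\<And>x. x \<in> B \<Longrightarrow> norm x \<le> r"
    using assms bounded_pos by blast
  have "- r \<le> x \<bullet> i \<and> x \<bullet> i \<le> r" if "x \<in> B" "i \<in> Basis" for x i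
    using Basis_le_norm[OF that(2), of x] r(2)[OF that(1)] by linarith
  then show thesis
    using r by (intro that[of r]) (auto simp: mem_box)
qed

text \<open>
  Countable subadditivity and the scaling behaviour of Lebesgue measure determine a set function up to
  a factor. On cubes this is the scaling hypothesis. Covering a set
  economically by cubes gives an upper bound; applied to the complement of \<open>A\<close> in a large cube, the same
  upper bound turns into a lower bound for \<open>A\<close>, since the value on the large cube is known.
\<close>

lemma uniqueness_of_affine_scaling_measure:
  fixes \<phi> :: "'a::euclidean_space set \<Rightarrow> ennreal"
  assumes mono: "\<And>A B. A \<in> sets borel \<Longrightarrow> B \<in> sets borel \<Longrightarrow> A \<subseteq> B \<Longrightarrow> \<phi> A \<le> \<phi> B"
    and empty: "\<phi> {} = 0"
    and subadd: "\<And>A :: nat \<Rightarrow> 'a set. range A \<subseteq> sets borel \<Longrightarrow> \<phi> (\<Union>i. A i) \<le> (\<Sum>i. \<phi> (A i))"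
    and affine: "\<And>a s A. A \<in> sets borel \<Longrightarrow> 0 < s \<Longrightarrow>
                   \<phi> ((\<lambda>x. a + s *\<^sub>R x) ` A) = ennreal (s ^ DIM('a)) * \<phi> A"
    and finite: "\<phi> (cbox 0 One) < \<infinity>"
    and A: "A \<in> sets borel" "bounded A"
  shows "\<phi> A = \<phi> (cbox 0 One) * emeasure lborel A"
proof -
  define c where "c = \<phi> (cbox 0 One)"
  have unit: "emeasure lborel (cbox 0 (One :: 'a)) = 1"
    by (simp add: emeasure_lborel_cbox_eq)
  have cube: "\<phi> (cbox u v) = c * emeasure lborel (cbox u v)"
    if s: "0 < s" and uv: "\<And>i. i \<in> Basis \<Longrightarrow> v \<bullet> i - u \<bullet> i = s" for u v :: 'a and s
  proof -
    have "v = u + s *\<^sub>R One"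
    proof (rule euclidean_eqI)
      fix i :: 'a assume "i \<in> Basis"
      then show "v \<bullet> i = (u + s *\<^sub>R One) \<bullet> i"
        using uv by (simp add: inner_add_left algebra_simps)
    qed
    then have "cbox u v = (\<lambda>x. u + s *\<^sub>R x) ` cbox 0 One"
      using s image_affinity_cbox[of s u 0 One]
      by (simp add: add.commute box_eq_empty)
    then show ?thesis
      using affine[of "cbox 0 One" s u] emeasure_lborel_affine_image[of "cbox 0 (One::'a)" s u] s unit
      by (simp add: c_def mult.commute)
  qed
  have upper: "\<phi> B \<le> c * emeasure lborel B" if B: "B \<in> sets borel" "bounded B" for B
  proof -
    obtain r where r: "0 < r" "B \<subseteq> cbox (- (r *\<^sub>R One)) (r *\<^sub>R One)"
      using bounded_in_centred_cube[OF B(2)] .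
    have Bm: "B \<in> lmeasurable"
      using B by (simp add: bounded_set_imp_lmeasurable)
    obtain c' where c': "c = ennreal c'" "0 \<le> c'"
      using finite by (cases c) (auto simp: c_def)
    show ?thesis
    proof (rule ennreal_le_epsilon)
      fix e :: real assume e: "0 < e"
      define e' where "e' = e / (c' + 1)"
      have e': "0 < e'" "c' * e' \<le> e"
        using e c' by (auto simp: e'_def field_simps)
      obtain \<D> where \<D>: "countable \<D>"
        "\<And>K. K \<in> \<D> \<Longrightarrow> K \<noteq> {} \<and> (\<exists>u v. K = cbox u v)"
        "pairwise (\<lambda>A B. interior A \<inter> interior B = {}) \<D>"
        "\<And>u v. cbox u v \<in> \<D> \<Longrightarrow> \<exists>n::nat. \<forall>i\<in>Basis. v \<bullet> i - u \<bullet> i = 2 * r / 2 ^ n"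
        "B \<subseteq> \<Union>\<D>" "\<Union>\<D> \<in> lmeasurable" "measure lebesgue (\<Union>\<D>) \<le> measure lebesgue B + e'"
        by (rule measurable_outer_intervals_bounded[OF Bm r(2) e'(1)])
           (simp add: inner_diff_left[symmetric]; blast)
      have \<D>_cube: "\<exists>u v s. K = cbox u v \<and> 0 < s \<and> (\<forall>i\<in>Basis. v \<bullet> i - u \<bullet> i = s)" if KD: "K \<in> \<D>" for K
      proof -
        obtain u v where K: "K = cbox u v" using \<D>(2) KD by blast
        then obtain n :: nat where "\<forall>i\<in>Basis. v \<bullet> i - u \<bullet> i = 2 * r / 2 ^ n" using \<D>(4) KD by blast
        moreover have "0 < 2 * r / 2 ^ n" using r by simp
        ultimately show ?thesis using K by blast
      qed
      \<comment> \<open>Repetition-free enumeration of the family by natural numbers, padded with empty sets.\<close>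
      define E where "E i = (if i \<in> to_nat_on \<D> ` \<D> then from_nat_into \<D> i else {})" for i
      have E_cases: "E i = {} \<or> E i \<in> \<D> \<and> to_nat_on \<D> (E i) = i" for i
        using \<D>(1) by (auto simp: E_def)
      have UE: "(\<Union>i. E i) = \<Union>\<D>"
      proof
        show "(\<Union>i. E i) \<subseteq> \<Union>\<D>" using E_cases by blast
        have "K = E (to_nat_on \<D> K)" if "K \<in> \<D>" for K
          using that \<D>(1) by (simp add: E_def)
        then show "\<Union>\<D> \<subseteq> (\<Union>i. E i)" by blast
      qed
      have E_borel: "E i \<in> sets borel" for i
        using E_cases[of i] \<D>_cube[of "E i"] by auto
      \<comment> \<open>Interiors of the cubes are disjoint and have the same volume as the closed cubes.\<close>
      have E_\<phi>: "\<phi> (E i) = c * emeasure lborel (interior (E i))" for i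
      proof (cases "E i = {}")
        case False
        then obtain u v s where "E i = cbox u v" "0 < s" "\<forall>i\<in>Basis. v \<bullet> i - u \<bullet> i = s"
          using E_cases \<D>_cube by metis
        then show ?thesis
          using cube[of s v u] by (simp add: emeasure_lborel_cbox_eq emeasure_lborel_box_eq interior_cbox)
      qed (simp add: empty)
      have disj: "disjoint_family (\<lambda>i. interior (E i))"
        unfolding disjoint_family_on_def
      proof (intro ballI impI)
        fix i j :: nat assume "i \<noteq> j"
        show "interior (E i) \<inter> interior (E j) = {}"
        proof (cases "E i = {} \<or> E j = {}")
          case False
          then have "E i \<in> \<D>" "E j \<in> \<D>" "E i \<noteq> E j"
            using E_cases[of i] E_cases[of j] \<open>i \<noteq> j\<close> by metis+
          then show ?thesis using \<D>(3) by (simp add: pairwise_def)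
        qed auto
      qed
      have "(\<Union>i. E i) \<in> sets borel"
        using E_borel by (intro sets.countable_UN) auto
      then have "\<phi> B \<le> \<phi> (\<Union>i. E i)"
        using B \<D>(5) UE by (intro mono) auto
      also have "\<dots> \<le> (\<Sum>i. \<phi> (E i))"
        using E_borel by (intro subadd) auto
      also have "\<dots> = c * (\<Sum>i. emeasure lborel (interior (E i)))"
        by (simp add: E_\<phi>)
      also have "(\<Sum>i. emeasure lborel (interior (E i))) = emeasure lborel (\<Union>i. interior (E i))"
        by (rule suminf_emeasure) (use disj in auto)
      also have "c * emeasure lborel (\<Union>i. interior (E i)) \<le> c * emeasure lborel (\<Union>i. E i)"
      proof (intro mult_left_mono emeasure_mono)
        show "(\<Union>i. interior (E i)) \<subseteq> (\<Union>i. E i)" using interior_subset by blast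
        show "(\<Union>i. E i) \<in> sets lborel" using E_borel by auto
      qed simp
      also have "emeasure lborel (\<Union>i. E i) = emeasure lebesgue (\<Union>\<D>)"
        using E_borel by (simp flip: UE)
      also have "\<dots> = ennreal (measure lebesgue (\<Union>\<D>))"
        using \<D>(6) by (simp add: emeasure_eq_measure2)
      also have "\<dots> \<le> ennreal (measure lebesgue B) + ennreal e'"
        using \<D>(7) e' by (simp flip: ennreal_plus)
      also have "ennreal (measure lebesgue B) = emeasure lebesgue B"
        using Bm by (simp add: emeasure_eq_measure2)
      also have "\<dots> = emeasure lborel B" using B by simp
      also have "c * (emeasure lborel B + ennreal e') = c * emeasure lborel B + ennreal (c' * e')"
        using c' e' by (simp add: distrib_left ennreal_mult)
      also have "\<dots> \<le> c * emeasure lborel B + ennreal e"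
        using e' by (intro add_left_mono ennreal_leI)
      finally show "\<phi> B \<le> c * emeasure lborel B + ennreal e"
        by (simp add: mult_left_mono)
    qed
  qed
  obtain r where r: "0 < r" "A \<subseteq> cbox (- (r *\<^sub>R One)) (r *\<^sub>R One)"
    using bounded_in_centred_cube[OF A(2)] .
  define W :: "'a set" where "W = cbox (- (r *\<^sub>R One)) (r *\<^sub>R One)"
  have W: "W \<in> sets borel" "bounded W" "A \<subseteq> W" using r by (auto simp: W_def)
  have fin: "c * emeasure lborel (W - A) < \<infinity>"
  proof -
    have "emeasure lborel (W - A) < \<infinity>"
      using W by (intro emeasure_bounded_finite) auto
    then show ?thesis using finite by (simp add: c_def ennreal_mult_less_top)
  qed
  have "c * emeasure lborel A + c * emeasure lborel (W - A) = c * emeasure lborel W"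
    using W A by (subst distrib_left[symmetric], subst plus_emeasure) (auto simp: Un_absorb1)
  also have "\<dots> = \<phi> W"
    unfolding W_def by (rule cube[of "2 * r", symmetric]) (use r in auto)
  also have "\<dots> \<le> \<phi> A + \<phi> (W - A)"
  proof -
    define E where "E i = (if i = 0 then A else if i = 1 then W - A else {})" for i :: nat
    have "\<phi> (\<Union>i. E i) \<le> (\<Sum>i. \<phi> (E i))"
      using A W by (intro subadd) (auto simp: E_def)
    also have "(\<Sum>i. \<phi> (E i)) = (\<Sum>i\<in>{0, 1}. \<phi> (E i))"
      by (rule suminf_finite) (auto simp: E_def empty)
    also have "\<dots> = \<phi> A + \<phi> (W - A)" by (simp add: E_def)
    also have "(\<Union>i. E i) = W" using W by (auto simp: E_def split: if_splits)
    finally show ?thesis .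
  qed
  also have "\<dots> \<le> \<phi> A + c * emeasure lborel (W - A)"
    using W A by (intro add_left_mono upper) (auto intro: bounded_subset)
  finally have "c * emeasure lborel A \<le> \<phi> A"
    using fin by (auto simp: add.commute[of _ "c * emeasure lborel (W - A)"] ennreal_add_left_cancel_le)
  with upper[OF A] show ?thesis by (simp add: c_def)
qed


text \<open>
  The volume of the image scales in the same way as Lebesgue measure, so it is a multiple of it; the
  factor is 1 because the unit ball is mapped onto the unit ball.
\<close>

lemma isometry_preserves_lborel:
  fixes f :: "'a::euclidean_space \<Rightarrow> 'b::euclidean_space"
  assumes lin: "linear f" and iso: "\<And>x. norm (f x) = norm x" and surj: "surj f"
    and dim: "DIM('a) = DIM('b)"
    and A: "A \<in> sets borel" "bounded A"
  shows "f ` A \<in> sets borel" "emeasure lborel (f ` A) = emeasure lborel A"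
proof -
  have dist: "dist (f x) (f y) = dist x y" for x y
    by (simp add: dist_norm iso flip: linear_diff[OF lin])
  then have inj: "inj f"
    by (metis dist_eq_0_iff injI)
  have g: "f (inv f y) = y" for y
    by (simp add: surj surj_f_inv_f)
  have g_dist: "dist (inv f y) (inv f z) = dist y z" for y z
    using dist[of "inv f y" "inv f z"] g by simp
  have "continuous_on UNIV (inv f)"
    by (auto simp: continuous_on_iff g_dist)
  then have [measurable]: "inv f \<in> borel_measurable borel"
    by (rule borel_measurable_continuous_onI)
  have image_borel: "f ` B \<in> sets borel" if [measurable]: "B \<in> sets borel" for B
  proof -
    have "f ` B = {y \<in> space borel. inv f y \<in> B}"
      using g inj by (auto simp: image_iff) (metis g)
    also have "\<dots> \<in> sets borel" by measurable
    finally show ?thesis .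
  qed
  then show "f ` A \<in> sets borel" using A by simp
  define \<phi> where "\<phi> B = emeasure lborel (f ` B)" for B
  have unique: "\<phi> B = \<phi> (cbox 0 One) * emeasure lborel B" if B: "B \<in> sets borel" "bounded B" for B
  proof (rule uniqueness_of_affine_scaling_measure)
    show "\<phi> B \<le> \<phi> C" if "B \<in> sets borel" "C \<in> sets borel" "B \<subseteq> C" for B C
      unfolding \<phi>_def using that image_borel by (intro emeasure_mono) auto
    show "\<phi> (\<Union>i. C i) \<le> (\<Sum>i. \<phi> (C i))" if "range C \<subseteq> sets borel" for C :: "nat \<Rightarrow> 'a set"
      unfolding \<phi>_def image_UN using that image_borel
      by (intro emeasure_subadditive_countably) auto
    show "\<phi> ((\<lambda>x. a + s *\<^sub>R x) ` C) = ennreal (s ^ DIM('a)) * \<phi> C"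
      if "C \<in> sets borel" "0 < s" for a s C
    proof -
      have "f ` (\<lambda>x. a + s *\<^sub>R x) ` C = (\<lambda>y. f a + s *\<^sub>R y) ` f ` C"
        by (simp add: image_image linear_add[OF lin] linear_scale[OF lin])
      then show ?thesis
        unfolding \<phi>_def using emeasure_lborel_affine_image[OF image_borel[OF that(1)] that(2)] dim by simp
    qed
    have "bounded (f ` cbox 0 One)"
      by (intro bounded_linear_image bounded_cbox) (simp add: linear_linear lin linear_conv_bounded_linear[symmetric])
    then show "\<phi> (cbox 0 One) < \<infinity>"
      unfolding \<phi>_def by (rule emeasure_bounded_finite)
  qed (use B in \<open>auto simp: \<phi>_def\<close>)
  have "f ` ball 0 1 = ball 0 1"
  proof (intro equalityI subsetI)
    fix y :: 'b assume "y \<in> ball 0 1"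
    then have "inv f y \<in> ball 0 1" using iso[of "inv f y"] g by simp
    then show "y \<in> f ` ball 0 1" using g by (metis imageI)
  qed (auto simp: iso)
  then have "ennreal (unit_ball_vol (DIM('b))) = \<phi> (cbox 0 One) * ennreal (unit_ball_vol (DIM('b)))"
    using unique[of "ball 0 1"] by (simp add: \<phi>_def emeasure_ball dim)
  then have "ennreal (unit_ball_vol (DIM('b))) * 1 = ennreal (unit_ball_vol (DIM('b))) * \<phi> (cbox 0 One)"
    by (simp add: mult.commute)
  moreover have "0 < unit_ball_vol (DIM('b))"
    by (rule unit_ball_vol_pos) simp
  ultimately have "\<phi> (cbox 0 One) = 1"
    unfolding ennreal_mult_cancel_left by (auto simp del: unit_ball_vol_pos)
  then show "emeasure lborel (f ` A) = emeasure lborel A"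
    using unique[OF A] by (simp add: \<phi>_def)
qed

text \<open>
  The constant factor between Hausdorff and Lebesgue measure in full dimension.
\<close>

definition hausdorff_cube :: "'a::euclidean_space itself \<Rightarrow> ennreal" where
  "hausdorff_cube _ = hausdorff_measure DIM('a) (cbox 0 (One :: 'a))"

text \<open>
  At scale \<open>k / m\<close>, the cube is covered by \<open>(m + 1) ^ k\<close> cubes of side \<open>1 / m\<close>. The total
  contribution stays below a bound that does not depend on \<open>m\<close>.
\<close>

lemma hausdorff_cube_finite: "hausdorff_cube TYPE('a::euclidean_space) < \<infinity>"
proof -
  define k where "k = DIM('a)"
  have "k > 0" by (simp add: k_def)
  define Q where "Q = cbox 0 (One :: 'a)"
  define c where "c = unit_ball_vol (real k) * real k ^ k"
  have "hausdorff_pre k \<delta> Q \<le> ennreal c" if \<delta>: "0 < \<delta>" for \<delta>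
  proof -
    obtain m :: nat where m: "real k / \<delta> < real m"
      using reals_Archimedean2 by blast
    moreover have "0 < real k / \<delta>" using \<delta> \<open>k > 0\<close> by simp
    ultimately have "0 < m" by linarith
    with m \<delta> have diam_le: "real k / real m \<le> \<delta>"
      by (simp add: field_simps)
    define I where "I = PiE (Basis :: 'a set) (\<lambda>_. {..m})"
    define C where "C p = {x :: 'a. \<forall>b\<in>Basis. real (p b) \<le> real m * (x \<bullet> b) \<and> real m * (x \<bullet> b) \<le> real (p b) + 1}"
      for p :: "'a \<Rightarrow> nat"
    have "finite I" and card_I: "card I = (m + 1) ^ k"
      by (simp_all add: I_def card_PiE k_def finite_PiE)
    have C_dist: "norm (x - y) \<le> real k / real m" if "x \<in> C p" "y \<in> C p" for x y p
    proof -
      have "norm (x - y) \<le> (\<Sum>b\<in>Basis. \<bar>(x - y) \<bullet> b\<bar>)" by (rule norm_le_l1)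
      also have "\<dots> \<le> (\<Sum>b\<in>(Basis :: 'a set). 1 / real m)"
      proof (rule sum_mono)
        fix b :: 'a assume "b \<in> Basis"
        then have "\<bar>real m * (x \<bullet> b) - real m * (y \<bullet> b)\<bar> \<le> 1"
          using \<open>x \<in> C p\<close> \<open>y \<in> C p\<close> by (fastforce simp: C_def)
        then have "real m * \<bar>(x - y) \<bullet> b\<bar> \<le> 1"
          by (simp add: inner_diff_left abs_mult flip: right_diff_distrib)
        then show "\<bar>(x - y) \<bullet> b\<bar> \<le> 1 / real m"
          using \<open>0 < m\<close> by (simp add: field_simps)
      qed
      finally show ?thesis by (simp add: k_def)
    qed
    have C_diam: "diameter (C p) \<le> real k / real m" for p
      by (rule diameter_le) (use C_dist in auto)
    have C_bdd: "bounded (C p)" for p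
      unfolding bounded_two_points dist_norm using C_dist by blast
    have "Q \<subseteq> (\<Union>p\<in>I. C p)"
    proof
      fix x assume x: "x \<in> Q"
      define p where "p = (\<lambda>b\<in>Basis. nat \<lfloor>real m * (x \<bullet> b)\<rfloor>)"
      have xb: "0 \<le> x \<bullet> b" "x \<bullet> b \<le> 1" if "b \<in> Basis" for b
        using x that by (auto simp: Q_def mem_box)
      have "p b \<le> m" if "b \<in> Basis" for b
      proof -
        have "real m * (x \<bullet> b) \<le> real m" using xb[OF that] by (simp add: mult_left_le)
        then have "\<lfloor>real m * (x \<bullet> b)\<rfloor> \<le> int m" by linarith
        then show ?thesis using that by (simp add: p_def)
      qed
      then have "p \<in> I" by (auto simp: I_def p_def)
      moreover have "x \<in> C p"
        unfolding C_def
      proof (intro CollectI ballI)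
        fix b :: 'a assume b: "b \<in> Basis"
        have "0 \<le> real m * (x \<bullet> b)" using xb[OF b] by simp
        then have "real (p b) = of_int \<lfloor>real m * (x \<bullet> b)\<rfloor>"
          using b by (simp add: p_def)
        then show "real (p b) \<le> real m * (x \<bullet> b) \<and> real m * (x \<bullet> b) \<le> real (p b) + 1"
          by linarith
      qed
      ultimately show "x \<in> (\<Union>p\<in>I. C p)" by blast
    qed
    then have "hausdorff_pre k \<delta> Q \<le> hausdorff_pre k \<delta> (\<Union>p\<in>I. C p)"
      by (rule hausdorff_pre_mono)
    also have "\<dots> \<le> (\<Sum>p\<in>I. hausdorff_pre k \<delta> (C p))"
      using \<delta> by (intro finite_subadditive_if_countably \<open>finite I\<close> hausdorff_pre_empty
          hausdorff_pre_countably_subadditive) simp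
    also have "\<dots> \<le> (\<Sum>p\<in>I. ennreal (unit_ball_vol (real k) * (real k / real m / 2) ^ k))"
    proof (rule sum_mono)
      fix p
      have "hausdorff_pre k \<delta> (C p) \<le> diam_content k (C p)"
        using \<delta> C_bdd order_trans[OF C_diam diam_le] by (intro hausdorff_pre_le_diam_content) auto
      also have "\<dots> \<le> ennreal (unit_ball_vol (real k) * (diameter (C p) / 2) ^ k)"
        by (simp add: diam_content_def)
      also have "\<dots> \<le> ennreal (unit_ball_vol (real k) * (real k / real m / 2) ^ k)"
        using C_diam[of p] diameter_ge_0[OF C_bdd[of p]]
        by (intro ennreal_leI mult_left_mono power_mono divide_right_mono) auto
      finally show "hausdorff_pre k \<delta> (C p) \<le> \<dots>" .
    qed
    also have "\<dots> = ennreal (real ((m + 1) ^ k) * (unit_ball_vol (real k) * (real k / real m / 2) ^ k))"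
      by (simp only: sum_constant card_I) (simp add: ennreal_mult ennreal_of_nat_eq_real_of_nat flip: of_nat_power)
    also have "\<dots> \<le> ennreal c"
    proof (rule ennreal_leI)
      have "real (m + 1) * (real k / real m / 2) \<le> real k"
        using mult_left_mono[of "real (m + 1)" "2 * real m" "real k"] \<open>0 < m\<close> by (simp add: field_simps)
      then have "(real (m + 1) * (real k / real m / 2)) ^ k \<le> real k ^ k"
        by (intro power_mono) auto
      then have "unit_ball_vol (real k) * (real (m + 1) * (real k / real m / 2)) ^ k \<le> c"
        unfolding c_def by (intro mult_left_mono) auto
      then show "real ((m + 1) ^ k) * (unit_ball_vol (real k) * (real k / real m / 2) ^ k) \<le> c"
        by (simp only: power_mult_distrib of_nat_power mult.left_commute)
    qed
    finally show ?thesis .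
  qed
  then have "hausdorff_measure k Q \<le> ennreal c"
    by (rule hausdorff_measure_least)
  then show ?thesis
    unfolding hausdorff_cube_def k_def Q_def by (simp add: order_le_less_trans)
qed

text \<open>
  A set of diameter \<open>d\<close> lies in a cube of side \<open>2 * d\<close>, so its contribution to a covering sum is at least
  a fixed multiple of the volume of that cube; the cubes together have volume at least 1.
\<close>

lemma hausdorff_cube_pos: "0 < hausdorff_cube TYPE('a::euclidean_space)"
proof -
  define k where "k = DIM('a)"
  define Q where "Q = cbox 0 (One :: 'a)"
  define c where "c = 4 ^ k / unit_ball_vol (real k)"
  have c: "0 < c" by (simp add: c_def)
  have ubv: "unit_ball_vol (real k) \<noteq> 0"
    using unit_ball_vol_pos[of "real k"] by (metis less_irrefl of_nat_0_le_iff)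
  have "ennreal (1 / c) \<le> hausdorff_pre k 1 Q"
  proof (rule hausdorff_pre_greatest)
    fix C assume C: "C \<in> fine_covers 1 Q"
    note C' = fine_coversD[OF C]
    define p where "p i = (SOME x. x \<in> C i)" for i
    define B where "B i = (if C i = {} then {} else
      cbox (p i - diameter (C i) *\<^sub>R One) (p i + diameter (C i) *\<^sub>R One))" for i
    have "C i \<subseteq> B i" for i
    proof
      fix x assume x: "x \<in> C i"
      then have "p i \<in> C i" unfolding p_def by (rule someI)
      have "\<bar>(x - p i) \<bullet> b\<bar> \<le> diameter (C i)" if "b \<in> Basis" for b
        using Basis_le_norm[OF that, of "x - p i"] diameter_bounded_bound[OF C'(2) x \<open>p i \<in> C i\<close>]
        by (simp add: dist_norm)
      then have "- diameter (C i) \<le> (x - p i) \<bullet> b \<and> (x - p i) \<bullet> b \<le> diameter (C i)" if "b \<in> Basis" for b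
        using that abs_le_iff by fastforce
      then show "x \<in> B i"
        using x by (fastforce simp: B_def mem_box inner_diff_left inner_add_left)
    qed
    then have "(\<Union>i. C i) \<subseteq> (\<Union>i. B i)" by (intro UN_mono) auto
    with C'(1) have QB: "Q \<subseteq> (\<Union>i. B i)" by (rule order_trans)
    have B_vol: "emeasure lborel (B i) = ennreal c * diam_content k (C i)" for i
    proof (cases "C i = {}")
      case False
      have d: "0 \<le> diameter (C i)" using C'(2) by (rule diameter_ge_0)
      have "emeasure lborel (B i) = ennreal (\<Prod>b\<in>(Basis::'a set). 2 * diameter (C i))"
        using False d by (simp add: B_def emeasure_lborel_cbox_eq inner_diff_left inner_add_left)
      also have "(\<Prod>b\<in>(Basis::'a set). 2 * diameter (C i)) = (2 * diameter (C i)) ^ k"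
        by (simp add: k_def)
      also have "\<dots> = (4 * (diameter (C i) / 2)) ^ k" by simp
      also have "\<dots> = c * (unit_ball_vol (real k) * (diameter (C i) / 2) ^ k)"
        unfolding power_mult_distrib using ubv by (simp add: c_def)
      finally show ?thesis
        using False c d by (simp add: diam_content_def ennreal_mult)
    qed (simp add: B_def)
    have "1 = emeasure lborel Q" by (simp add: Q_def emeasure_lborel_cbox_eq)
    also have "\<dots> \<le> emeasure lborel (\<Union>i. B i)"
      by (rule emeasure_mono[OF QB]) (auto simp: B_def)
    also have "\<dots> \<le> (\<Sum>i. emeasure lborel (B i))"
      by (rule emeasure_subadditive_countably) (auto simp: B_def)
    also have "\<dots> = ennreal c * (\<Sum>i. diam_content k (C i))" by (simp add: B_vol)
    finally have "ennreal (1 / c) * 1 \<le> ennreal (1 / c) * (ennreal c * (\<Sum>i. diam_content k (C i)))"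
      by (rule mult_left_mono) simp
    then show "ennreal (1 / c) \<le> (\<Sum>i. diam_content k (C i))"
      using c by (simp add: mult.assoc[symmetric] flip: ennreal_mult)
  qed
  also have "\<dots> \<le> hausdorff_measure k Q" by (rule hausdorff_pre_le_measure) simp
  finally show ?thesis
    unfolding hausdorff_cube_def k_def Q_def using c
    by (metis ennreal_less_zero_iff less_le_trans zero_less_divide_1_iff)
qed

lemma hausdorff_measure_eq_lborel:
  fixes A :: "'a::euclidean_space set"
  assumes "A \<in> sets borel" "bounded A"
  shows "hausdorff_measure DIM('a) A = hausdorff_cube TYPE('a) * emeasure lborel A"
  unfolding hausdorff_cube_def
proof (rule uniqueness_of_affine_scaling_measure)
  show "hausdorff_measure DIM('a) (cbox 0 (One :: 'a)) < \<infinity>"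
    using hausdorff_cube_finite[where 'a='a] by (simp add: hausdorff_cube_def)
qed (use assms in \<open>simp_all add: hausdorff_measure_mono hausdorff_measure_countably_subadditive
       hausdorff_measure_affine_image\<close>)

section \<open>Hausdorff measure of flat sets as cone volume\<close>

text \<open>
  The volume factor \<open>1 / (k + 1)\<close> of a pyramid over a \<open>k\<close>-dimensional base.
\<close>

definition cone_factor :: "nat \<Rightarrow> ennreal" where
  "cone_factor k = (\<integral>\<^sup>+t. indicator {0<..1} t * ennreal (t ^ k) \<partial>lborel)"

lemma cone_factor_finite: "cone_factor k < \<infinity>"
proof -
  have "cone_factor k \<le> (\<integral>\<^sup>+t. indicator {0<..1::real} t \<partial>lborel)"
    unfolding cone_factor_def
    by (intro nn_integral_mono) (auto simp: indicator_def power_le_one)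
  also have "\<dots> = 1" by (simp add: emeasure_lborel_Ioc)
  finally show ?thesis by (simp add: order_le_less_trans)
qed

lemma cone_factor_pos: "0 < cone_factor k"
proof -
  have "0 < ennreal ((1/2) ^ k * (1/2))" by simp
  also have "\<dots> = (\<integral>\<^sup>+t. ennreal ((1/2) ^ k) * indicator {1/2..1::real} t \<partial>lborel)"
    by (simp add: nn_integral_cmult_indicator ennreal_mult[symmetric] del: ennreal_half)
  also have "\<dots> \<le> cone_factor k"
    unfolding cone_factor_def
    by (intro nn_integral_mono) (auto simp: indicator_def intro!: ennreal_leI power_mono)
  finally show ?thesis .
qed

text \<open>
  The slice of the cone at height \<open>t\<close> is the base shrunk by the factor \<open>t\<close>.
\<close>

lemma emeasure_cone_over:
  fixes A :: "'a::euclidean_space set"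
  assumes [measurable]: "A \<in> sets borel"
  defines "X \<equiv> {(t::real, a). 0 < t \<and> t \<le> 1 \<and> (1 / t) *\<^sub>R a \<in> A}"
  shows "X \<in> sets borel" "emeasure lborel X = cone_factor DIM('a) * emeasure lborel A"
proof -
  have "X = {p \<in> space (borel \<Otimes>\<^sub>M borel). 0 < fst p \<and> fst p \<le> 1 \<and> (1 / fst p) *\<^sub>R snd p \<in> A}"
    by (auto simp: X_def space_pair_measure)
  also have "\<dots> \<in> sets (borel \<Otimes>\<^sub>M borel)" by measurable
  finally have X: "X \<in> sets (borel \<Otimes>\<^sub>M borel)" .
  then show "X \<in> sets borel" by (simp only: borel_prod)
  have slice: "emeasure lborel (Pair t -` X) = indicator {0<..1} t * ennreal (t ^ DIM('a)) * emeasure lborel A" for t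
  proof (cases "0 < t \<and> t \<le> 1")
    case True
    then have "Pair t -` X = (\<lambda>x. 0 + t *\<^sub>R x) ` A"
      by (auto simp: X_def image_iff intro!: bexI[of _ "(1 / t) *\<^sub>R _"])
    then show ?thesis
      using True emeasure_lborel_affine_image[OF assms(1), of t 0] by simp
  next
    case False
    then have "Pair t -` X = {}" by (auto simp: X_def)
    with False show ?thesis by (auto simp: indicator_def)
  qed
  have "emeasure lborel X = emeasure (lborel \<Otimes>\<^sub>M lborel) X"
    by (simp add: lborel_prod)
  also have "\<dots> = (\<integral>\<^sup>+t. emeasure lborel (Pair t -` X) \<partial>lborel)"
    using X by (intro lborel.emeasure_pair_measure_alt) (simp cong: sets_pair_measure_cong)
  also have "\<dots> = cone_factor DIM('a) * emeasure lborel A"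
    unfolding slice cone_factor_def by (rule nn_integral_multc) measurable
  finally show "emeasure lborel X = cone_factor DIM('a) * emeasure lborel A" .
qed

text \<open>
  The constant \<open>\<kappa>\<close> in the cone formula: hypersurface area is \<open>\<kappa>\<close> times the volume of the cone, divided by
  the distance of the tangent plane from the origin.
\<close>

definition flat_ratio :: "'k::euclidean_space itself \<Rightarrow> ennreal" where
  "flat_ratio _ = hausdorff_cube TYPE('k) / cone_factor DIM('k)"

lemma flat_ratio_finite: "flat_ratio TYPE('k::euclidean_space) < \<infinity>"
  unfolding flat_ratio_def using hausdorff_cube_finite[where 'a='k] cone_factor_pos[of "DIM('k)"]
  by (auto simp: ennreal_divide_eq_top_iff less_top[symmetric])

lemma flat_ratio_pos: "0 < flat_ratio TYPE('k::euclidean_space)"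
  unfolding flat_ratio_def using hausdorff_cube_pos[where 'a='k] cone_factor_finite[of "DIM('k)"]
  by (auto simp: ennreal_zero_less_divide)

text \<open>
  The area of a piece of a hyperplane in terms of the volume of the cone over it. The hyperplane has
  distance \<open>1 / norm w\<close> from the origin, which accounts for the factor \<open>norm w\<close>. With \<open>\<nu>\<close> the unit
  normal and \<open>f\<close> a linear isometry onto the orthogonal complement of \<open>\<nu>\<close>, the map
  \<open>(t, a) \<mapsto> t *\<^sub>R \<nu> + f a\<close> is a linear isometry, and up to the homothety by \<open>1 / norm w\<close> it takes the
  cone over \<open>A\<close> to the cone over \<open>B\<close>.
\<close>

lemma hausdorff_measure_flat:
  fixes B :: "'n::euclidean_space set" and w :: 'n
  assumes dim: "DIM('n) = Suc DIM('k::euclidean_space)"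
    and w: "w \<noteq> 0" and B: "B \<in> sets borel" "bounded B" and plane: "\<And>y. y \<in> B \<Longrightarrow> y \<bullet> w = 1"
  shows "hausdorff_measure DIM('k) B = flat_ratio TYPE('k) * ennreal (norm w) *
           emeasure lborel {y. 0 < y \<bullet> w \<and> y \<bullet> w \<le> 1 \<and> (1 / (y \<bullet> w)) *\<^sub>R y \<in> B}"
proof -
  define k where "k = DIM('k)"
  define s where "s = 1 / norm w"
  define \<nu> where "\<nu> = s *\<^sub>R w"
  have s: "0 < s" using w by (simp add: s_def)
  have \<nu>: "norm \<nu> = 1" "\<nu> \<bullet> \<nu> = 1"
    using w by (auto simp: \<nu>_def s_def dot_square_norm)
  have w_eq: "w = (1 / s) *\<^sub>R \<nu>" using s by (simp add: \<nu>_def)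
  have "dim {y. \<nu> \<bullet> y = 0} = DIM('k)"
    using \<nu>(2) dim by (subst dim_hyperplane) auto
  then obtain f :: "'k \<Rightarrow> 'n" where f: "linear f" "f ` UNIV = {y. \<nu> \<bullet> y = 0}" "\<And>x. norm (f x) = norm x"
    using isometry_subspaces[of "UNIV :: 'k set" "{y. \<nu> \<bullet> y = 0}"] by (auto simp: subspace_hyperplane)
  have f_orth: "\<nu> \<bullet> f a = 0" for a using f(2) by blast
  have f_dist: "dist (f x) (f y) = dist x y" for x y
    by (simp add: dist_norm f(3) flip: linear_diff[OF f(1)])
  have [measurable]: "f \<in> borel_measurable borel"
    using f(1) by (intro borel_measurable_continuous_onI linear_continuous_on)
      (simp add: linear_conv_bounded_linear)
  have [measurable]: "B \<in> sets borel" by (rule B)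
  define A where "A = {a. s *\<^sub>R (\<nu> + f a) \<in> B}"
  have A_borel: "A \<in> sets borel"
  proof -
    have "A = {a \<in> space borel. s *\<^sub>R (\<nu> + f a) \<in> B}" by (simp add: A_def)
    also have "\<dots> \<in> sets borel" by measurable
    finally show ?thesis .
  qed
  obtain r where r: "\<And>y. y \<in> B \<Longrightarrow> norm y \<le> r" using B(2) bounded_iff by blast
  have A_norm: "norm a \<le> r / s + 1" if "a \<in> A" for a
  proof -
    have "s * norm (\<nu> + f a) \<le> r"
      using r[of "s *\<^sub>R (\<nu> + f a)"] that s by (simp add: A_def)
    then have "norm (\<nu> + f a) \<le> r / s" using s by (simp add: field_simps)
    moreover have "norm (f a) \<le> norm (\<nu> + f a) + norm \<nu>"
      by (metis add_diff_cancel_left' norm_triangle_ineq4)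
    ultimately show ?thesis using \<nu>(1) f(3) by simp
  qed
  then have A_bdd: "bounded A" unfolding bounded_iff by blast
  have decompose: "\<exists>a. y = (\<nu> \<bullet> y) *\<^sub>R \<nu> + f a" for y
  proof -
    have "\<nu> \<bullet> (y - (\<nu> \<bullet> y) *\<^sub>R \<nu>) = 0"
      using \<nu>(2) by (simp add: inner_diff_right)
    then obtain a where "f a = y - (\<nu> \<bullet> y) *\<^sub>R \<nu>" using f(2) by (metis (mono_tags) imageE mem_Collect_eq)
    then show ?thesis by (metis add.commute diff_add_cancel)
  qed
  have B_eq: "B = (\<lambda>y. s *\<^sub>R \<nu> + s *\<^sub>R y) ` f ` A"
  proof (intro equalityI subsetI)
    fix y assume y: "y \<in> B"
    obtain a where a: "(1 / s) *\<^sub>R y = (\<nu> \<bullet> ((1 / s) *\<^sub>R y)) *\<^sub>R \<nu> + f a" using decompose by blast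
    have one: "\<nu> \<bullet> ((1 / s) *\<^sub>R y) = 1" using plane[OF y] by (simp add: w_eq inner_commute)
    have "(1 / s) *\<^sub>R y = \<nu> + f a" using a unfolding one scaleR_one .
    then have y_eq: "y = s *\<^sub>R (\<nu> + f a)" using s by (metis divide_self less_irrefl mult.right_neutral scaleR_one scaleR_scaleR times_divide_eq_right)
    with y have "a \<in> A" by (simp add: A_def)
    then show "y \<in> (\<lambda>y. s *\<^sub>R \<nu> + s *\<^sub>R y) ` f ` A" using y_eq by (auto simp: scaleR_add_right)
  qed (auto simp: A_def scaleR_add_right)
  have lhs: "hausdorff_measure k B = ennreal (s ^ k) * (hausdorff_cube TYPE('k) * emeasure lborel A)"
    unfolding B_eq using s A_borel A_bdd f_dist
    by (simp add: hausdorff_measure_affine_image hausdorff_measure_isometric_image k_def hausdorff_measure_eq_lborel)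
  define F where "F = (\<lambda>(t::real, a). t *\<^sub>R \<nu> + f a)"
  have F_lin: "linear F"
    unfolding F_def by (rule linearI) (auto simp: linear_add[OF f(1)] linear_scale[OF f(1)] algebra_simps)
  have F_norm: "norm (F p) = norm p" for p
  proof (cases p)
    case (Pair t a)
    have "(norm (t *\<^sub>R \<nu> + f a))\<^sup>2 = (norm (t *\<^sub>R \<nu>))\<^sup>2 + (norm (f a))\<^sup>2"
      by (intro norm_add_Pythagorean) (simp add: orthogonal_def f_orth)
    then have "(norm (F p))\<^sup>2 = (norm p)\<^sup>2"
      using \<nu>(1) f(3) by (simp add: F_def Pair norm_Pair)
    then show ?thesis by simp
  qed
  have F_surj: "surj F"
    unfolding surj_def F_def using decompose by auto metis
  define X where "X = {(t::real, a). 0 < t \<and> t \<le> 1 \<and> (1 / t) *\<^sub>R a \<in> A}"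
  note X = emeasure_cone_over[OF A_borel, folded X_def]
  have X_bdd: "bounded X"
  proof -
    have "norm a \<le> \<bar>r / s + 1\<bar>" "\<bar>t\<bar> \<le> 1" if "(t, a) \<in> X" for t a
    proof -
      have t: "0 < t" "t \<le> 1" "(1 / t) *\<^sub>R a \<in> A" using that by (auto simp: X_def)
      then have "norm a \<le> t * (r / s + 1)" using A_norm[of "(1 / t) *\<^sub>R a"] by (simp add: field_simps)
      also have "\<dots> \<le> t * \<bar>r / s + 1\<bar>" using t by (intro mult_left_mono) auto
      also have "\<dots> \<le> 1 * \<bar>r / s + 1\<bar>" using t by (intro mult_right_mono) auto
      finally show "norm a \<le> \<bar>r / s + 1\<bar>" by simp
    qed (use that in \<open>auto simp: X_def\<close>)
    then have "X \<subseteq> cball 0 1 \<times> cball 0 \<bar>r / s + 1\<bar>" by auto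
    then show ?thesis by (rule bounded_subset[rotated]) (intro bounded_Times bounded_cball)
  qed
  have FX: "F ` X \<in> sets borel" "emeasure lborel (F ` X) = emeasure lborel X"
    by (rule isometry_preserves_lborel[OF F_lin F_norm F_surj _ X(1) X_bdd]; simp add: dim)+
  have cone_eq: "{y. 0 < y \<bullet> w \<and> y \<bullet> w \<le> 1 \<and> (1 / (y \<bullet> w)) *\<^sub>R y \<in> B} = (\<lambda>x. 0 + s *\<^sub>R x) ` F ` X"
  proof (intro equalityI subsetI)
    fix y assume "y \<in> {y. 0 < y \<bullet> w \<and> y \<bullet> w \<le> 1 \<and> (1 / (y \<bullet> w)) *\<^sub>R y \<in> B}"
    then have y: "0 < y \<bullet> w" "y \<bullet> w \<le> 1" "(1 / (y \<bullet> w)) *\<^sub>R y \<in> B" by auto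
    define t where "t = y \<bullet> w"
    obtain a where a: "(1 / s) *\<^sub>R y = (\<nu> \<bullet> ((1 / s) *\<^sub>R y)) *\<^sub>R \<nu> + f a" using decompose by blast
    have t: "\<nu> \<bullet> ((1 / s) *\<^sub>R y) = t" by (simp add: t_def w_eq inner_commute)
    have "(1 / s) *\<^sub>R y = t *\<^sub>R \<nu> + f a" using a unfolding t .
    then have y_eq: "y = s *\<^sub>R (t *\<^sub>R \<nu> + f a)" using s by (metis divide_self less_irrefl mult.right_neutral scaleR_one scaleR_scaleR times_divide_eq_right)
    have "(1 / t) *\<^sub>R y = s *\<^sub>R (\<nu> + f ((1 / t) *\<^sub>R a))"
      using y(1)[folded t_def] unfolding y_eq by (simp add: linear_scale[OF f(1)] scaleR_add_right)
    with y(3) have "(1 / t) *\<^sub>R a \<in> A" by (simp add: A_def t_def)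
    then have "(t, a) \<in> X" using y by (simp add: X_def t_def)
    then show "y \<in> (\<lambda>x. 0 + s *\<^sub>R x) ` F ` X" using y_eq by (force simp: F_def)
  next
    fix y assume "y \<in> (\<lambda>x. 0 + s *\<^sub>R x) ` F ` X"
    then obtain t a where ta: "(t, a) \<in> X" "y = s *\<^sub>R (t *\<^sub>R \<nu> + f a)" by (auto simp: F_def)
    then have t: "0 < t" "t \<le> 1" "(1 / t) *\<^sub>R a \<in> A" by (auto simp: X_def)
    have "y \<bullet> w = \<nu> \<bullet> (t *\<^sub>R \<nu> + f a)"
      using s by (simp add: ta(2) w_eq inner_commute)
    also have "\<dots> = t"
      using \<nu>(2) f_orth by (simp add: inner_add_right)
    finally have "y \<bullet> w = t" .
    moreover have "(1 / t) *\<^sub>R y = s *\<^sub>R (\<nu> + f ((1 / t) *\<^sub>R a))"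
      using t(1) unfolding ta(2) by (simp add: linear_scale[OF f(1)] scaleR_add_right)
    ultimately show "y \<in> {y. 0 < y \<bullet> w \<and> y \<bullet> w \<le> 1 \<and> (1 / (y \<bullet> w)) *\<^sub>R y \<in> B}"
      using t by (simp add: A_def)
  qed
  have "flat_ratio TYPE('k) * cone_factor k = hausdorff_cube TYPE('k)"
    unfolding flat_ratio_def k_def using cone_factor_pos cone_factor_finite
    by (metis ennreal_divide_times ennreal_times_divide infinity_ennreal_def less_irrefl mult_1_right ennreal_divide_self)
  moreover have "ennreal (norm w) * ennreal (s ^ Suc k) = ennreal (s ^ k)"
    using w by (simp add: s_def flip: ennreal_mult)
  moreover have "emeasure lborel ((\<lambda>x. 0 + s *\<^sub>R x) ` F ` X) = ennreal (s ^ Suc k) * (cone_factor k * emeasure lborel A)"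
    using emeasure_lborel_affine_image[OF FX(1) s, of 0] FX(2) X(2) dim by (simp add: k_def)
  ultimately show ?thesis
    unfolding cone_eq k_def[symmetric] lhs by (metis (no_types, lifting) mult.assoc mult.left_commute)
qed

section \<open>From local comparison to equality of measures\<close>

lemma ennreal_le_if_le_all_multiples:
  fixes x y :: ennreal
  assumes le: "\<And>\<rho>::real. 1 < \<rho> \<Longrightarrow> x \<le> ennreal \<rho> * y"
  shows "x \<le> y"
proof (cases y)
  case (real r)
  show ?thesis
  proof (rule ennreal_le_epsilon)
    fix e :: real assume e: "0 < e"
    define \<rho> where "\<rho> = 1 + e / (r + 1)"
    have \<rho>: "1 < \<rho>" using e real by (simp add: \<rho>_def)
    have "\<rho> * r \<le> r + e"
      using e real by (simp add: \<rho>_def field_simps)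
    then have "ennreal \<rho> * y \<le> y + ennreal e"
      using real e \<rho> by (simp add: ennreal_leI flip: ennreal_mult ennreal_plus)
    then show "x \<le> y + ennreal e"
      using le[OF \<rho>] by (rule order_trans[rotated])
  qed
qed simp

text \<open>
  Partitioning \<open>S\<close> into finitely many small Borel pieces and using subadditivity bounds
  its Hausdorff measure by \<open>\<rho>\<close> times its \<open>\<mu>\<close>-measure. For the lower bound, inner regularity of \<open>\<mu>\<close> provides compact subsets of the
  pieces that carry almost all of \<open>\<mu>\<close>; being disjoint and compact they are at positive
  distance from each other, and so their Hausdorff measures add up.
\<close>

lemma hausdorff_measure_eq_if_locally_comparable:
  fixes S :: "'a::euclidean_space set" and \<mu> :: "'a measure"
  assumes sets: "sets \<mu> = sets borel" and fin: "emeasure \<mu> (space \<mu>) \<noteq> \<infinity>" and S: "compact S"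
    and local: "\<And>\<rho>::real. 1 < \<rho> \<Longrightarrow> \<exists>\<delta>>0. \<forall>p\<in>S. \<forall>A\<in>sets borel. A \<subseteq> S \<inter> ball p \<delta> \<longrightarrow>
      hausdorff_measure k A \<le> ennreal \<rho> * emeasure \<mu> A \<and> emeasure \<mu> A \<le> ennreal \<rho> * hausdorff_measure k A"
  shows "hausdorff_measure k S = emeasure \<mu> S"
proof -
  have S_borel: "S \<in> sets borel" using S by (simp add: compact_imp_closed)
  have both: "hausdorff_measure k S \<le> ennreal \<rho> * emeasure \<mu> S \<and> emeasure \<mu> S \<le> ennreal \<rho> * hausdorff_measure k S"
    if \<rho>: "1 < \<rho>" for \<rho>
  proof -
    obtain \<delta> where \<delta>: "0 < \<delta>" "\<And>p A. p \<in> S \<Longrightarrow> A \<in> sets borel \<Longrightarrow> A \<subseteq> S \<inter> ball p \<delta> \<Longrightarrow>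
      hausdorff_measure k A \<le> ennreal \<rho> * emeasure \<mu> A \<and> emeasure \<mu> A \<le> ennreal \<rho> * hausdorff_measure k A"
      using local[OF \<rho>] by blast
    obtain P where P: "finite P" "P \<subseteq> S" "S \<subseteq> (\<Union>p\<in>P. ball p \<delta>)"
      using S \<delta>(1) compact_imp_seq_compact seq_compact_imp_totally_bounded by metis
    obtain p where p: "bij_betw p {..<card P} P"
      using P(1) ex_bij_betw_nat_finite lessThan_atLeast0 by metis
    define N where "N = card P"
    have p_S: "p j \<in> S" if "j < N" for j
      using p that P(2) bij_betwE N_def by blast
    have p_cover: "S \<subseteq> (\<Union>j<N. ball (p j) \<delta>)"
    proof -
      have "S \<subseteq> (\<Union>q\<in>p ` {..<N}. ball q \<delta>)"
        using P(3) by (simp only: bij_betw_imp_surj_on[OF p] N_def)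
      then show ?thesis by simp
    qed
    define A where "A j = S \<inter> ball (p j) \<delta> - (\<Union>i<j. ball (p i) \<delta>)" for j
    have A_borel: "A j \<in> sets borel" for j
      unfolding A_def using S_borel by (intro sets.Diff sets.Int sets.finite_UN) auto
    have A_disj: "disjoint_family A"
      unfolding disjoint_family_on_def
    proof (intro ballI impI)
      fix i j :: nat assume "i \<noteq> j"
      then show "A i \<inter> A j = {}"
        by (cases i j rule: linorder_cases) (auto simp: A_def)
    qed
    have UA: "(\<Union>j<N. A j) = S"
    proof
      show "S \<subseteq> (\<Union>j<N. A j)"
      proof
        fix x assume x: "x \<in> S"
        define j where "j = (LEAST j. x \<in> ball (p j) \<delta>)"
        obtain i where i: "i < N" "x \<in> ball (p i) \<delta>" using p_cover x by blast
        have "x \<in> ball (p j) \<delta>" unfolding j_def using i(2) by (rule LeastI)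
        moreover have "j \<le> i" unfolding j_def using i(2) by (rule Least_le)
        moreover have "x \<notin> ball (p l) \<delta>" if "l < j" for l
          using that not_less_Least unfolding j_def by blast
        ultimately show "x \<in> (\<Union>j<N. A j)" using x i(1) by (auto simp: A_def)
      qed
    qed (auto simp: A_def)
    have A_comp: "hausdorff_measure k B \<le> ennreal \<rho> * emeasure \<mu> B \<and> emeasure \<mu> B \<le> ennreal \<rho> * hausdorff_measure k B"
      if "j < N" "B \<in> sets borel" "B \<subseteq> A j" for j B
      using that p_S by (intro \<delta>(2)[of "p j"]) (auto simp: A_def)
    have sum_A: "(\<Sum>j<N. emeasure \<mu> (A j)) = emeasure \<mu> S"
      using A_borel A_disj sets by (subst sum_emeasure) (auto simp: UA disjoint_family_on_def)
    have "hausdorff_measure k S \<le> (\<Sum>j<N. hausdorff_measure k (A j))"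
      using hausdorff_measure_finite_subadditive[of "{..<N}" k A] UA by simp
    also have "\<dots> \<le> (\<Sum>j<N. ennreal \<rho> * emeasure \<mu> (A j))"
      using A_comp A_borel by (intro sum_mono) auto
    also have "\<dots> = ennreal \<rho> * emeasure \<mu> S"
      by (simp add: sum_distrib_left[symmetric] sum_A)
    finally have upper: "hausdorff_measure k S \<le> ennreal \<rho> * emeasure \<mu> S" .
    have "emeasure \<mu> S \<le> ennreal \<rho> * hausdorff_measure k S"
    proof (rule ennreal_le_epsilon)
      fix e :: real assume e: "0 < e"
      define e' where "e' = e / (real N + 1)"
      have e': "0 < e'" "real N * e' \<le> e" using e by (auto simp: e'_def field_simps)
      have "\<exists>K. compact K \<and> K \<subseteq> A j \<and> emeasure \<mu> (A j) \<le> emeasure \<mu> K + ennreal e'" for j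
      proof -
        have "emeasure \<mu> (A j) = (SUP K\<in>{K. K \<subseteq> A j \<and> compact K}. emeasure \<mu> K)"
          using sets fin A_borel by (intro inner_regular) auto
        moreover have "emeasure \<mu> (A j) \<noteq> \<infinity>"
          using fin emeasure_space[of \<mu> "A j"] by (auto simp: top_unique)
        ultimately have "\<exists>K\<in>{K. K \<subseteq> A j \<and> compact K}. emeasure \<mu> (A j) < emeasure \<mu> K + ennreal e'"
          using e' by (intro SUP_approx_ennreal) auto
        then show ?thesis by (auto intro: less_imp_le)
      qed
      then obtain K where K: "\<And>j. compact (K j)" "\<And>j. K j \<subseteq> A j"
        "\<And>j. emeasure \<mu> (A j) \<le> emeasure \<mu> (K j) + ennreal e'"
        by metis
      have K_disj: "disjoint_family_on K {..<N}"
        using A_disj K(2) unfolding disjoint_family_on_def by blast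
      have "emeasure \<mu> S \<le> (\<Sum>j<N. emeasure \<mu> (K j) + ennreal e')"
        unfolding sum_A[symmetric] by (intro sum_mono K(3))
      also have "\<dots> = (\<Sum>j<N. emeasure \<mu> (K j)) + ennreal (real N * e')"
        using e' by (simp add: sum.distrib ennreal_mult ennreal_of_nat_eq_real_of_nat)
      also have "\<dots> \<le> (\<Sum>j<N. ennreal \<rho> * hausdorff_measure k (K j)) + ennreal e"
      proof (intro add_mono sum_mono ennreal_leI e'(2))
        fix j assume "j \<in> {..<N}"
        then show "emeasure \<mu> (K j) \<le> ennreal \<rho> * hausdorff_measure k (K j)"
          using A_comp[of j "K j"] K(2) borel_compact[OF K(1)] by auto
      qed
      also have "(\<Sum>j<N. ennreal \<rho> * hausdorff_measure k (K j)) = ennreal \<rho> * (\<Sum>j<N. hausdorff_measure k (K j))"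
        by (simp add: sum_distrib_left)
      also have "(\<Sum>j<N. hausdorff_measure k (K j)) \<le> hausdorff_measure k (\<Union>j<N. K j)"
        using K(1) K_disj by (intro hausdorff_measure_disjoint_compacts) auto
      also have "\<dots> \<le> hausdorff_measure k S"
        using K(2) UA by (intro hausdorff_measure_mono) blast
      finally show "emeasure \<mu> S \<le> ennreal \<rho> * hausdorff_measure k S + ennreal e"
        by (simp add: mult_left_mono)
    qed
    with upper show ?thesis by blast
  qed
  show ?thesis
    by (rule antisym; rule ennreal_le_if_le_all_multiples) (use both in blast)+
qed

section \<open>Surface area of an ellipsoid\<close>

text \<open>
  Self-adjointness of \<open>D\<close> is what makes \<open>D (D x)\<close> the normal direction of the surface \<open>norm (D x) = 1\<close>
  at \<open>x\<close>: the function \<open>(norm (D x))\<^sup>2\<close> has gradient \<open>2 *\<^sub>R D (D x)\<close>.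
\<close>

locale ellipsoid_map =
  fixes D :: "'a::euclidean_space \<Rightarrow> 'a"
  assumes lin: "linear D"
    and self_adjoint: "x \<bullet> D y = D x \<bullet> y"
    and nonsing: "D x = 0 \<Longrightarrow> x = 0"
begin

definition surface :: "'a set" where "surface = {x. norm (D x) = 1}"

definition normal :: "'a \<Rightarrow> 'a" where "normal x = D (D x)"

definition radial :: "'a \<Rightarrow> 'a" where "radial x = (1 / norm (D x)) *\<^sub>R x"

text \<open>
  On the ray through a surface point \<open>p\<close>, the density is the reciprocal of the distance between the origin
  and the tangent plane at \<open>p\<close>. Up to a factor that depends on the dimension only, the cone
  over an infinitesimal surface piece then receives the area of that piece as its mass.
\<close>

definition cone_density :: "'a \<Rightarrow> ennreal" where
  "cone_density x = indicator {x. norm (D x) \<le> 1} x * ennreal (norm (normal (radial x)))"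

text \<open>
  Pushing the mass of each ray to its surface point turns the weighted volume into a Borel measure
  carried by the surface.
\<close>

definition cone_measure :: "'a measure" where
  "cone_measure = distr (density lborel cone_density) borel radial"

lemma D_continuous: "continuous_on UNIV D"
  using lin by (simp add: linear_continuous_on linear_conv_bounded_linear)

lemma D_measurable [measurable]: "D \<in> borel_measurable borel"
  by (rule borel_measurable_continuous_onI[OF D_continuous])

lemma normal_measurable [measurable]: "normal \<in> borel_measurable borel"
  unfolding normal_def[abs_def] by measurable

lemma radial_measurable [measurable]: "radial \<in> borel_measurable borel"
  unfolding radial_def[abs_def] by measurable

lemma cone_density_measurable [measurable]: "cone_density \<in> borel_measurable borel"
  unfolding cone_density_def[abs_def] by measurable

lemma D_scale: "D (c *\<^sub>R x) = c *\<^sub>R D x"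
  by (rule linear_scale[OF lin])

lemma normal_linear: "linear normal"
  unfolding normal_def[abs_def] using linear_compose[OF lin lin] by (simp add: o_def)

lemma normal_scale: "normal (c *\<^sub>R x) = c *\<^sub>R normal x"
  by (rule linear_scale[OF normal_linear])

lemma inner_normal: "x \<bullet> normal y = D x \<bullet> D y"
  by (simp add: normal_def self_adjoint)

lemma inner_normal_self: "x \<in> surface \<Longrightarrow> x \<bullet> normal x = 1"
  by (simp add: inner_normal surface_def dot_square_norm)

lemma radial_scale: "0 < c \<Longrightarrow> radial (c *\<^sub>R x) = radial x"
  by (simp add: radial_def D_scale)

lemma radial_surface: "x \<in> surface \<Longrightarrow> radial x = x"
  by (simp add: radial_def surface_def)

lemma surface_bounds:
  obtains M where "1 \<le> M" "\<And>v. norm (normal v) \<le> M * norm v"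
    "\<And>x. x \<in> surface \<Longrightarrow> norm x \<le> M" "\<And>x. x \<in> surface \<Longrightarrow> norm (normal x) \<le> M"
    "\<And>x. x \<in> surface \<Longrightarrow> 1 \<le> M * norm (normal x)"
proof -
  obtain C where C: "0 < C" "\<And>x. norm (D x) \<le> C * norm x"
    using linear_bounded_pos[OF lin] by blast
  have "inj D"
    using linear_injective_0[OF lin] nonsing by blast
  then obtain b where b: "0 < b" "\<And>x. b * norm x \<le> norm (D x)"
    using linear_inj_bounded_below_pos[OF lin] by blast
  define M where "M = 1 + C + C * C + 1 / b"
  have M: "1 \<le> M" "C \<le> M" "C * C \<le> M" "1 / b \<le> M" using b(1) C(1) by (auto simp: M_def)
  show thesis
  proof
    show "norm (normal v) \<le> M * norm v" for v
    proof -
      have "norm (normal v) \<le> C * (C * norm v)"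
        unfolding normal_def using C by (meson mult_left_mono less_imp_le order_trans)
      also have "\<dots> \<le> M * norm v"
        using M(3) by (simp add: mult.assoc[symmetric] mult_right_mono)
      finally show ?thesis .
    qed
    fix x assume x: "x \<in> surface"
    have x_b: "norm x \<le> 1 / b"
      using b(2)[of x] x b(1) by (simp add: surface_def field_simps)
    then show "norm x \<le> M" using M(4) by linarith
    show "norm (normal x) \<le> M"
      unfolding normal_def using C(2)[of "D x"] x M(2) by (simp add: surface_def)
    have "1 \<le> norm x * norm (normal x)"
      using Cauchy_Schwarz_ineq2[of x "normal x"] inner_normal_self[OF x] by simp
    also have "\<dots> \<le> M * norm (normal x)"
      using x_b M(4) by (intro mult_right_mono) auto
    finally show "1 \<le> M * norm (normal x)" .
  qed (rule M(1))
qed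

lemma surface_compact: "compact surface"
proof -
  obtain M where M: "\<And>x. x \<in> surface \<Longrightarrow> norm x \<le> M" using surface_bounds by metis
  have "closed surface"
    unfolding surface_def by (intro closed_Collect_eq continuous_intros D_continuous)
  moreover have "bounded surface" using M unfolding bounded_iff by blast
  ultimately show ?thesis by (simp add: compact_eq_bounded_closed)
qed

lemma solid_bounded: "bounded {x. norm (D x) \<le> 1}"
proof -
  obtain M where M: "\<And>x. x \<in> surface \<Longrightarrow> norm x \<le> M" "1 \<le> M" using surface_bounds by metis
  have "norm x \<le> M" if x: "norm (D x) \<le> 1" for x
  proof (cases "D x = 0")
    case False
    then have "norm (radial x) \<le> M"
      by (intro M) (simp add: surface_def radial_def D_scale)
    then have "norm x \<le> M * norm (D x)" using False by (simp add: radial_def field_simps)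
    also have "\<dots> \<le> M" using x M(2) by (simp add: mult_left_le)
    finally show ?thesis .
  qed (use M(2) nonsing in force)
  then show ?thesis unfolding bounded_iff by blast
qed

lemma emeasure_cone_measure:
  assumes [measurable]: "A \<in> sets borel"
  shows "emeasure cone_measure A = (\<integral>\<^sup>+x. cone_density x * indicator A (radial x) \<partial>lborel)"
proof -
  have "emeasure cone_measure A = emeasure (density lborel cone_density) {x \<in> space borel. radial x \<in> A}"
    unfolding cone_measure_def by (subst emeasure_distr) (auto intro!: arg_cong2[where f=emeasure])
  also have "\<dots> = (\<integral>\<^sup>+x. cone_density x * indicator {x \<in> space borel. radial x \<in> A} x \<partial>lborel)"
    by (subst emeasure_density) auto
  finally show ?thesis by (simp add: indicator_def)
qed

lemma cone_measure_finite: "emeasure cone_measure (space cone_measure) \<noteq> \<infinity>"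
proof -
  obtain M where M: "1 \<le> M" "\<And>x. x \<in> surface \<Longrightarrow> norm (normal x) \<le> M" using surface_bounds by metis
  have "cone_density x \<le> ennreal M * indicator {x. norm (D x) \<le> 1} x" for x
  proof (cases "D x = 0")
    case True
    then have "radial x = 0" using nonsing by (simp add: radial_def)
    then show ?thesis using linear_0[OF normal_linear] by (simp add: cone_density_def)
  next
    case False
    then have "radial x \<in> surface" by (simp add: surface_def radial_def D_scale)
    then show ?thesis using M(2) by (auto simp: cone_density_def indicator_def ennreal_leI)
  qed
  then have "emeasure cone_measure UNIV \<le> (\<integral>\<^sup>+x. ennreal M * indicator {x. norm (D x) \<le> 1} x \<partial>lborel)"
    by (subst emeasure_cone_measure) (auto intro!: nn_integral_mono)
  also have "\<dots> = ennreal M * emeasure lborel {x. norm (D x) \<le> 1}"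
    by (rule nn_integral_cmult_indicator) simp
  also have "\<dots> < \<infinity>"
    using emeasure_bounded_finite[OF solid_bounded] by (simp add: ennreal_mult_less_top)
  finally show ?thesis by (simp add: cone_measure_def)
qed

text \<open>
  The map \<open>x \<mapsto> x / (x \<bullet> w)\<close>, where \<open>w = normal p\<close>, is the central projection to the tangent plane at
  \<open>p\<close>. Its derivative at \<open>p\<close> is the identity along tangent directions, and chords of the surface near \<open>p\<close>
  are almost tangent. Explicit bounds make \<open>\<delta>\<close> independent of \<open>p\<close>.
\<close>

lemma flattening_distortion:
  assumes \<rho>: "(1::real) < \<rho>"
  obtains \<delta> where "0 < \<delta>"
    "\<And>p x. p \<in> surface \<Longrightarrow> x \<in> surface \<Longrightarrow> dist p x < \<delta> \<Longrightarrow>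
       1 / \<rho> \<le> x \<bullet> normal p \<and> x \<bullet> normal p \<le> \<rho> \<and>
       norm (normal x) \<le> \<rho> * norm (normal p) \<and> norm (normal p) \<le> \<rho> * norm (normal x)"
    "\<And>p x y. p \<in> surface \<Longrightarrow> x \<in> surface \<Longrightarrow> y \<in> surface \<Longrightarrow> dist p x < \<delta> \<Longrightarrow> dist p y < \<delta> \<Longrightarrow>
       dist ((1 / (x \<bullet> normal p)) *\<^sub>R x) ((1 / (y \<bullet> normal p)) *\<^sub>R y) \<le> \<rho> * dist x y \<and>
       dist x y \<le> \<rho> * dist ((1 / (x \<bullet> normal p)) *\<^sub>R x) ((1 / (y \<bullet> normal p)) *\<^sub>R y)"
proof -
  obtain M where M: "1 \<le> M" "\<And>v. norm (normal v) \<le> M * norm v"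
    "\<And>x. x \<in> surface \<Longrightarrow> norm x \<le> M" "\<And>x. x \<in> surface \<Longrightarrow> norm (normal x) \<le> M"
    "\<And>x. x \<in> surface \<Longrightarrow> 1 \<le> M * norm (normal x)"
    by (rule surface_bounds) blast
  \<comment> \<open>A relative error of at most \<open>\<eta>\<close> is harmless in both directions: \<open>1 - \<eta> = 1 / \<rho>\<close> and
     \<open>1 + \<eta> \<le> \<rho>\<close>.\<close>
  define \<eta> where "\<eta> = 1 - 1 / \<rho>"
  have \<eta>: "0 < \<eta>" "\<eta> < 1" "1 / \<rho> = 1 - \<eta>" using \<rho> by (auto simp: \<eta>_def field_simps)
  have \<eta>\<rho>: "1 + \<eta> \<le> \<rho>"
  proof -
    have "0 \<le> (\<rho> - 1)\<^sup>2" by simp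
    then show ?thesis using \<rho> by (simp add: \<eta>_def field_simps power2_eq_square)
  qed
  define \<delta> where "\<delta> = \<eta> / (6 * M\<^sup>2)"
  have \<delta>: "0 < \<delta>" using \<eta> M(1) by (simp add: \<delta>_def)
  have \<delta>M2: "6 * (M * M * \<delta>) = \<eta>" using M(1) by (simp add: \<delta>_def power2_eq_square)
  have \<delta>M: "M * \<delta> \<le> M * M * \<delta>" using M(1) \<delta> by (simp add: mult_right_mono)
  have near: "\<bar>x \<bullet> normal p - 1\<bar> \<le> M * \<delta>" if "p \<in> surface" "x \<in> surface" "dist p x < \<delta>" for p x
  proof -
    have "x \<bullet> normal p - 1 = (x - p) \<bullet> normal p"
      using inner_normal_self[OF that(1)] by (simp add: inner_diff_left)
    then have "\<bar>x \<bullet> normal p - 1\<bar> \<le> norm (x - p) * norm (normal p)"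
      using Cauchy_Schwarz_ineq2[of "x - p" "normal p"] by simp
    also have "\<dots> \<le> \<delta> * M"
      using that(3) M(4)[OF that(1)] \<delta> by (intro mult_mono) (auto simp: dist_norm norm_minus_commute)
    finally show ?thesis by (simp add: mult.commute)
  qed
  show thesis
  proof
    show "0 < \<delta>" by (rule \<delta>)
  next
    fix p x assume p: "p \<in> surface" and x: "x \<in> surface" and px: "dist p x < \<delta>"
    have "norm (normal x - normal p) \<le> M * norm (x - p)"
      using M(2)[of "x - p"] by (simp add: linear_diff[OF normal_linear])
    also have "\<dots> \<le> M * \<delta>"
      using px M(1) by (intro mult_left_mono) (auto simp: dist_norm norm_minus_commute)
    also have "\<dots> \<le> (M * \<delta>) * (M * norm (normal p))"
      using M(5)[OF p] mult_left_mono[of 1 "M * norm (normal p)" "M * \<delta>"] M(1) \<delta> by simp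
    also have "\<dots> = (M * M * \<delta>) * norm (normal p)" by simp
    also have "\<dots> \<le> \<eta> * norm (normal p)"
      using \<delta>M2 \<eta>(1) by (intro mult_right_mono) auto
    finally have diff: "norm (normal x - normal p) \<le> \<eta> * norm (normal p)" .
    have "norm (normal x) \<le> norm (normal p) + norm (normal x - normal p)"
      by (metis add.commute diff_add_cancel norm_triangle_ineq)
    also have "\<dots> \<le> (1 + \<eta>) * norm (normal p)" using diff by (simp add: algebra_simps)
    also have "\<dots> \<le> \<rho> * norm (normal p)" using \<eta>\<rho> by (intro mult_right_mono) auto
    finally have up: "norm (normal x) \<le> \<rho> * norm (normal p)" .
    have "norm (normal p) \<le> norm (normal x) + norm (normal x - normal p)"
      by (metis norm_minus_commute norm_triangle_sub)
    with diff have "(1 - \<eta>) * norm (normal p) \<le> norm (normal x)" by (simp add: algebra_simps)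
    then have low: "norm (normal p) \<le> \<rho> * norm (normal x)"
      using \<rho> unfolding \<eta>(3)[symmetric] by (simp add: field_simps)
    show "1 / \<rho> \<le> x \<bullet> normal p \<and> x \<bullet> normal p \<le> \<rho> \<and>
       norm (normal x) \<le> \<rho> * norm (normal p) \<and> norm (normal p) \<le> \<rho> * norm (normal x)"
      using near[OF p x px] \<delta>M \<delta>M2 \<eta> \<eta>\<rho> up low by (auto simp: abs_le_iff)
  next
    fix p x y assume p: "p \<in> surface" and x: "x \<in> surface" and y: "y \<in> surface"
      and px: "dist p x < \<delta>" and py: "dist p y < \<delta>"
    define w where "w = normal p"
    define a where "a = x \<bullet> w"
    define b where "b = y \<bullet> w"
    have ab: "\<bar>a - 1\<bar> \<le> M * \<delta>" "\<bar>b - 1\<bar> \<le> M * \<delta>"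
      using near[OF p x px] near[OF p y py] by (simp_all add: a_def b_def w_def)
    then have half: "1 / 2 \<le> a" "1 / 2 \<le> b"
      using \<delta>M \<delta>M2 \<eta>(2) by (auto simp: abs_le_iff)
    \<comment> \<open>Both end points of the chord lie on the surface, so it is orthogonal to
       \<open>normal (x + y)\<close>, which is close to \<open>2 *\<^sub>R normal p\<close>.\<close>
    have chord: "2 * (b - a) = (y - x) \<bullet> normal (2 *\<^sub>R p - x - y)"
    proof -
      have "(y - x) \<bullet> normal (x + y) = 0"
      proof -
        have "(y - x) \<bullet> normal (x + y) = (D y - D x) \<bullet> (D x + D y)"
          by (simp add: inner_normal linear_add[OF lin] linear_diff[OF lin])
        also have "\<dots> = D y \<bullet> D y - D x \<bullet> D x"
          by (simp add: inner_diff_left inner_add_right inner_commute[of "D y" "D x"])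
        finally show ?thesis using x y by (simp add: surface_def dot_square_norm)
      qed
      moreover have "normal (2 *\<^sub>R p - x - y) = 2 *\<^sub>R w - normal (x + y)"
        by (simp add: linear_diff[OF normal_linear] linear_add[OF normal_linear] normal_scale w_def)
      ultimately show ?thesis
        by (simp add: inner_diff_right a_def b_def inner_diff_left)
    qed
    have "norm (2 *\<^sub>R p - x - y) \<le> norm (p - x) + norm (p - y)"
      using norm_triangle_ineq[of "p - x" "p - y"] by (simp add: scaleR_2 algebra_simps)
    also have "\<dots> \<le> 2 * \<delta>" using px py by (simp add: dist_norm)
    finally have "norm (normal (2 *\<^sub>R p - x - y)) \<le> M * (2 * \<delta>)"
      using M(1) order_trans[OF M(2) mult_left_mono] by fastforce
    then have "\<bar>2 * (b - a)\<bar> \<le> norm (y - x) * (M * (2 * \<delta>))"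
      unfolding chord using Cauchy_Schwarz_ineq2 mult_left_mono[of _ _ "norm (y - x)"]
      by (meson norm_ge_zero order_trans)
    then have ba: "\<bar>b - a\<bar> \<le> M * \<delta> * norm (x - y)"
      by (simp add: abs_mult norm_minus_commute algebra_simps)
    \<comment> \<open>The deviation of the projection from an isometry; \<open>\<delta>\<close> is chosen so that its two parts
       add up to at most \<open>\<eta> * norm (x - y)\<close>.\<close>
    define E where "E = (1 / a) *\<^sub>R x - (1 / b) *\<^sub>R y - (x - y)"
    have "E = (1 / a - 1) *\<^sub>R (x - y) + ((b - a) / (a * b)) *\<^sub>R y"
    proof -
      have diff: "(b - a) / (a * b) = 1 / a - 1 / b" using half by (simp add: field_simps)
      show ?thesis unfolding E_def diff by (simp add: algebra_simps)
    qed
    then have "norm E \<le> \<bar>1 / a - 1\<bar> * norm (x - y) + \<bar>(b - a) / (a * b)\<bar> * norm y"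
      by (metis norm_scaleR norm_triangle_ineq)
    also have "\<dots> \<le> (2 * (M * \<delta>)) * norm (x - y) + (4 * (M * \<delta> * norm (x - y))) * M"
    proof (intro add_mono mult_mono M(3) y)
      have "\<bar>1 / a - 1\<bar> = \<bar>a - 1\<bar> / a"
        using half by (simp add: abs_if field_simps)
      also have "\<dots> \<le> (M * \<delta>) / (1 / 2)"
        using half ab M(1) \<delta> by (intro frac_le) auto
      finally show "\<bar>1 / a - 1\<bar> \<le> 2 * (M * \<delta>)" by simp
      have "1 / 4 \<le> a * b" using mult_mono[OF half] half by simp
      then have "\<bar>(b - a) / (a * b)\<bar> \<le> (M * \<delta> * norm (x - y)) / (1 / 4)"
        unfolding abs_divide using ba half M(1) \<delta> by (intro frac_le) auto
      then show "\<bar>(b - a) / (a * b)\<bar> \<le> 4 * (M * \<delta> * norm (x - y))" by simp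
    qed (use M(1) \<delta> in auto)
    also have "\<dots> \<le> (2 * (M * M * \<delta>)) * norm (x - y) + (4 * (M * M * \<delta>)) * norm (x - y)"
      using \<delta>M by (intro add_mono mult_right_mono) (auto simp: algebra_simps)
    also have "\<dots> = \<eta> * norm (x - y)"
      unfolding \<delta>M2[symmetric] by (simp add: algebra_simps)
    finally have E: "norm E \<le> \<eta> * norm (x - y)" .
    let ?d = "norm ((1 / a) *\<^sub>R x - (1 / b) *\<^sub>R y)"
    have "?d \<le> norm (x - y) + norm E"
      unfolding E_def by (metis add.commute diff_add_cancel norm_triangle_ineq)
    also have "\<dots> \<le> (1 + \<eta>) * norm (x - y)" using E by (simp add: algebra_simps)
    also have "\<dots> \<le> \<rho> * norm (x - y)" using \<eta>\<rho> by (intro mult_right_mono) auto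
    finally have up: "?d \<le> \<rho> * norm (x - y)" .
    have "norm (x - y) \<le> ?d + norm E"
      unfolding E_def by (metis norm_minus_commute norm_triangle_sub)
    with E have "(1 - \<eta>) * norm (x - y) \<le> ?d" by (simp add: algebra_simps)
    then have low: "norm (x - y) \<le> \<rho> * ?d"
      using \<rho> unfolding \<eta>(3)[symmetric] by (simp add: field_simps)
    show "dist ((1 / (x \<bullet> normal p)) *\<^sub>R x) ((1 / (y \<bullet> normal p)) *\<^sub>R y) \<le> \<rho> * dist x y \<and>
       dist x y \<le> \<rho> * dist ((1 / (x \<bullet> normal p)) *\<^sub>R x) ((1 / (y \<bullet> normal p)) *\<^sub>R y)"
      using up low by (simp add: dist_norm a_def b_def w_def)
  qed
qed


lemma cone_measure_comparison:
  assumes A: "A \<in> sets borel" and m: "0 \<le> m"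
  defines "C \<equiv> {y. norm (D y) \<le> 1 \<and> radial y \<in> A}"
  shows "(\<And>x. x \<in> A \<Longrightarrow> m \<le> norm (normal x)) \<Longrightarrow> ennreal m * emeasure lborel C \<le> emeasure cone_measure A"
    and "(\<And>x. x \<in> A \<Longrightarrow> norm (normal x) \<le> m) \<Longrightarrow> emeasure cone_measure A \<le> ennreal m * emeasure lborel C"
proof -
  note A [measurable]
  have "C = {y \<in> space borel. norm (D y) \<le> 1 \<and> radial y \<in> A}" by (simp add: C_def)
  also have "\<dots> \<in> sets borel" by measurable
  finally have [measurable]: "C \<in> sets borel" .
  have C_int: "ennreal m * emeasure lborel C = (\<integral>\<^sup>+x. ennreal m * indicator C x \<partial>lborel)"
    by (rule nn_integral_cmult_indicator[symmetric]) simp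
  show "ennreal m * emeasure lborel C \<le> emeasure cone_measure A"
    if "\<And>x. x \<in> A \<Longrightarrow> m \<le> norm (normal x)"
    unfolding C_int emeasure_cone_measure[OF A]
    by (intro nn_integral_mono) (auto simp: C_def cone_density_def indicator_def intro!: ennreal_leI that)
  show "emeasure cone_measure A \<le> ennreal m * emeasure lborel C"
    if "\<And>x. x \<in> A \<Longrightarrow> norm (normal x) \<le> m"
    unfolding C_int emeasure_cone_measure[OF A]
    by (intro nn_integral_mono) (auto simp: C_def cone_density_def indicator_def intro!: ennreal_leI that)
qed

text \<open>
  Each comparison between a small surface piece \<open>A\<close> and its central projection \<open>B\<close> to a tangent plane
  costs a power of \<open>\<rho>\<close>: \<open>k\<close> factors for the Hausdorff measures (bi-Lipschitz map), \<open>k + 1\<close> for the volumes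
  of the cones over \<open>A\<close> and \<open>B\<close> (each is contained in the dilation of the other by \<open>\<rho>\<close>), and one for
  replacing the varying normals by the normal at \<open>p\<close>. This explains the exponent \<open>2 * DIM('a)\<close>.
\<close>

lemma hausdorff_measure_small_piece:
  assumes dim: "DIM('a) = Suc DIM('k::euclidean_space)" and \<rho>: "(1::real) < \<rho>"
  obtains \<delta> where "0 < \<delta>"
    "\<And>p A. p \<in> surface \<Longrightarrow> A \<in> sets borel \<Longrightarrow> A \<subseteq> surface \<inter> ball p \<delta> \<Longrightarrow>
       hausdorff_measure DIM('k) A \<le> ennreal (\<rho> ^ (2 * DIM('a))) * (flat_ratio TYPE('k) * emeasure cone_measure A) \<and>
       flat_ratio TYPE('k) * emeasure cone_measure A \<le> ennreal (\<rho> ^ (2 * DIM('a))) * hausdorff_measure DIM('k) A"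
proof -
  define k where "k = DIM('k)"
  define \<kappa> where "\<kappa> = flat_ratio TYPE('k)"
  obtain \<delta> where \<delta>: "0 < \<delta>"
    "\<And>p x. p \<in> surface \<Longrightarrow> x \<in> surface \<Longrightarrow> dist p x < \<delta> \<Longrightarrow>
       1 / \<rho> \<le> x \<bullet> normal p \<and> x \<bullet> normal p \<le> \<rho> \<and>
       norm (normal x) \<le> \<rho> * norm (normal p) \<and> norm (normal p) \<le> \<rho> * norm (normal x)"
    "\<And>p x y. p \<in> surface \<Longrightarrow> x \<in> surface \<Longrightarrow> y \<in> surface \<Longrightarrow> dist p x < \<delta> \<Longrightarrow> dist p y < \<delta> \<Longrightarrow>
       dist ((1 / (x \<bullet> normal p)) *\<^sub>R x) ((1 / (y \<bullet> normal p)) *\<^sub>R y) \<le> \<rho> * dist x y \<and>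
       dist x y \<le> \<rho> * dist ((1 / (x \<bullet> normal p)) *\<^sub>R x) ((1 / (y \<bullet> normal p)) *\<^sub>R y)"
    by (rule flattening_distortion[OF \<rho>]) blast
  show thesis
  proof (rule that[OF \<delta>(1)], fold \<kappa>_def k_def)
    fix p A assume p: "p \<in> surface" and A [measurable]: "A \<in> sets borel" and sub: "A \<subseteq> surface \<inter> ball p \<delta>"
    define w where "w = normal p"
    define \<pi> where "\<pi> x = (1 / (x \<bullet> w)) *\<^sub>R x" for x
    have A_surface: "x \<in> surface" if "x \<in> A" for x using sub that by blast
    have A_close: "dist p x < \<delta>" if "x \<in> A" for x using sub that by auto
    have w0: "w \<noteq> 0" using inner_normal_self[OF p] by (auto simp: w_def)
    have height: "1 / \<rho> \<le> x \<bullet> w" "x \<bullet> w \<le> \<rho>" if "x \<in> A" for x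
      using \<delta>(2)[OF p A_surface A_close] that by (auto simp: w_def)
    have height_pos: "0 < x \<bullet> w" if "x \<in> A" for x
      using height(1)[OF that] \<rho> by (meson less_le_trans zero_less_divide_1_iff less_trans zero_less_one)
    have radial_\<pi>: "radial (\<pi> y) = radial y" if "0 < y \<bullet> w" for y
      using that by (simp add: \<pi>_def radial_scale)
    define B where "B = \<pi> ` A"
    have B_eq: "B = {b. b \<bullet> w = 1 \<and> radial b \<in> A}"
    proof (intro equalityI subsetI)
      fix b assume "b \<in> B"
      then obtain x where x: "x \<in> A" "b = \<pi> x" by (auto simp: B_def)
      then show "b \<in> {b. b \<bullet> w = 1 \<and> radial b \<in> A}"
        using height_pos[OF x(1)] radial_\<pi> radial_surface[OF A_surface] by (simp add: \<pi>_def)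
    next
      fix b assume "b \<in> {b. b \<bullet> w = 1 \<and> radial b \<in> A}"
      then have b: "b \<bullet> w = 1" "radial b \<in> A" by auto
      then have "norm (D b) \<noteq> 0"
        using height_pos[OF b(2)] by (auto simp: radial_def)
      then have "\<pi> (radial b) = b"
        by (simp add: \<pi>_def radial_def b(1))
      then show "b \<in> B" using b(2) unfolding B_def by (metis imageI)
    qed
    have B_borel: "B \<in> sets borel"
    proof -
      have "B = {b \<in> space borel. b \<bullet> w = 1 \<and> radial b \<in> A}" by (simp add: B_eq)
      also have "\<dots> \<in> sets borel" by measurable
      finally show ?thesis .
    qed
    have lip: "dist (\<pi> x) (\<pi> y) \<le> \<rho> * dist x y" "dist x y \<le> \<rho> * dist (\<pi> x) (\<pi> y)" if "x \<in> A" "y \<in> A" for x y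
      using \<delta>(3)[OF p A_surface A_surface A_close A_close, of x y] that by (auto simp: \<pi>_def w_def)
    have B_bdd: "bounded B"
    proof -
      have "bounded A"
        using sub compact_imp_bounded[OF surface_compact] bounded_subset by blast
      then obtain e where e: "\<And>x y. x \<in> A \<Longrightarrow> y \<in> A \<Longrightarrow> dist x y \<le> e"
        unfolding bounded_two_points by blast
      have "dist (\<pi> x) (\<pi> y) \<le> \<rho> * e" if "x \<in> A" "y \<in> A" for x y
        using lip(1)[OF that] mult_left_mono[OF e[OF that], of \<rho>] \<rho> by linarith
      then have "dist x y \<le> \<rho> * e" if "x \<in> B" "y \<in> B" for x y
        using that unfolding B_def by blast
      then show ?thesis unfolding bounded_two_points by blast
    qed
    \<comment> \<open>The cones over \<open>A\<close> and over its flattening \<open>B\<close>: they consist of the same rays, cut off at the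
       surface and at the tangent plane.\<close>
    define C where "C = {y. norm (D y) \<le> 1 \<and> radial y \<in> A}"
    define C' where "C' = {y. 0 < y \<bullet> w \<and> y \<bullet> w \<le> 1 \<and> (1 / (y \<bullet> w)) *\<^sub>R y \<in> B}"
    have C'_eq: "C' = {y. 0 < y \<bullet> w \<and> y \<bullet> w \<le> 1 \<and> radial y \<in> A}"
      unfolding C'_def B_eq using radial_\<pi> by (auto simp: \<pi>_def)
    have C_borel: "C \<in> sets borel"
    proof -
      have "C = {y \<in> space borel. norm (D y) \<le> 1 \<and> radial y \<in> A}" by (simp add: C_def)
      also have "\<dots> \<in> sets borel" by measurable
      finally show ?thesis .
    qed
    have C'_borel: "C' \<in> sets borel"
    proof -
      have "C' = {y \<in> space borel. 0 < y \<bullet> w \<and> y \<bullet> w \<le> 1 \<and> radial y \<in> A}" by (simp add: C'_eq)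
      also have "\<dots> \<in> sets borel" by measurable
      finally show ?thesis .
    qed
    have flat: "hausdorff_measure k B = \<kappa> * ennreal (norm w) * emeasure lborel C'"
      unfolding k_def \<kappa>_def C'_def
      using w0 B_borel B_bdd dim by (intro hausdorff_measure_flat) (auto simp: B_eq)
    have gauge: "y \<bullet> w = norm (D y) * (radial y \<bullet> w)" "0 < norm (D y)" if "radial y \<in> A" for y
    proof -
      have "norm (D y) \<noteq> 0" using height_pos[OF that] by (auto simp: radial_def)
      then show "y \<bullet> w = norm (D y) * (radial y \<bullet> w)" "0 < norm (D y)" by (auto simp: radial_def)
    qed
    have dilate: "y \<in> (\<lambda>x. 0 + \<rho> *\<^sub>R x) ` X" if "(1 / \<rho>) *\<^sub>R y \<in> X" for y :: 'a and X
      using that \<rho> by (intro image_eqI[of _ _ "(1 / \<rho>) *\<^sub>R y"]) auto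
    have "C' \<subseteq> (\<lambda>x. 0 + \<rho> *\<^sub>R x) ` C"
    proof (intro subsetI dilate)
      fix y assume "y \<in> C'"
      then have y: "y \<bullet> w \<le> 1" "radial y \<in> A" by (auto simp: C'_eq)
      have "norm (D y) * (1 / \<rho>) \<le> norm (D y) * (radial y \<bullet> w)"
        using height(1)[OF y(2)] by (intro mult_left_mono) auto
      then have "norm (D y) / \<rho> \<le> 1" using gauge(1)[OF y(2)] y(1) by simp
      then show "(1 / \<rho>) *\<^sub>R y \<in> C"
        using y(2) \<rho> radial_scale[of "1 / \<rho>" y] by (simp add: C_def D_scale)
    qed
    then have "emeasure lborel C' \<le> emeasure lborel ((\<lambda>x. 0 + \<rho> *\<^sub>R x) ` C)"
      using \<rho> C_borel by (intro emeasure_mono) (auto simp del: add_0 intro: affine_image_borel)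
    then have C'_le: "emeasure lborel C' \<le> ennreal (\<rho> ^ Suc k) * emeasure lborel C"
      using \<rho> by (subst (asm) emeasure_lborel_affine_image[OF C_borel]) (auto simp: dim k_def)
    have "C \<subseteq> (\<lambda>x. 0 + \<rho> *\<^sub>R x) ` C'"
    proof (intro subsetI dilate)
      fix y assume "y \<in> C"
      then have y: "norm (D y) \<le> 1" "radial y \<in> A" by (auto simp: C_def)
      have "norm (D y) * (radial y \<bullet> w) \<le> 1 * \<rho>"
        using height[OF y(2)] height_pos[OF y(2)] y(1) by (intro mult_mono) auto
      then have "y \<bullet> w \<le> \<rho>" using gauge(1)[OF y(2)] by simp
      moreover have "0 < y \<bullet> w" using gauge[OF y(2)] height_pos[OF y(2)] by simp
      ultimately show "(1 / \<rho>) *\<^sub>R y \<in> C'"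
        using y(2) \<rho> radial_scale[of "1 / \<rho>" y] by (simp add: C'_eq)
    qed
    then have "emeasure lborel C \<le> emeasure lborel ((\<lambda>x. 0 + \<rho> *\<^sub>R x) ` C')"
      using \<rho> C'_borel by (intro emeasure_mono) (auto simp del: add_0 intro: affine_image_borel)
    then have C_le: "emeasure lborel C \<le> ennreal (\<rho> ^ Suc k) * emeasure lborel C'"
      using \<rho> by (subst (asm) emeasure_lborel_affine_image[OF C'_borel]) (auto simp: dim k_def)
    have normals: "norm w / \<rho> \<le> norm (normal x)" "norm (normal x) \<le> \<rho> * norm w" if "x \<in> A" for x
      using \<delta>(2)[OF p A_surface A_close] that \<rho> by (auto simp: w_def field_simps)
    have mult_\<rho>: "ennreal \<rho> * ennreal (norm w / \<rho>) = ennreal (norm w)"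
      using \<rho> by (simp flip: ennreal_mult)
    have "ennreal (norm w / \<rho>) * emeasure lborel C \<le> emeasure cone_measure A"
      unfolding C_def using \<rho> normals(1) by (intro cone_measure_comparison(1) A) auto
    then have "ennreal \<rho> * (ennreal (norm w / \<rho>) * emeasure lborel C) \<le> ennreal \<rho> * emeasure cone_measure A"
      by (rule mult_left_mono) simp
    then have \<mu>_ge: "ennreal (norm w) * emeasure lborel C \<le> ennreal \<rho> * emeasure cone_measure A"
      by (simp only: mult.assoc[symmetric] mult_\<rho>)
    have \<mu>_le: "emeasure cone_measure A \<le> ennreal (\<rho> * norm w) * emeasure lborel C"
      unfolding C_def using \<rho> normals(2) by (intro cone_measure_comparison(2) A) auto
    have "radial ` B = A"
    proof -
      have "radial (\<pi> x) = x" if "x \<in> A" for x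
        using radial_\<pi>[OF height_pos[OF that]] radial_surface[OF A_surface[OF that]] by simp
      then show ?thesis by (simp add: B_def image_image)
    qed
    moreover have "hausdorff_measure k (radial ` B) \<le> ennreal (\<rho> ^ k) * hausdorff_measure k B"
    proof (rule hausdorff_measure_lipschitz_image)
      fix b b' assume "b \<in> B" "b' \<in> B"
      then obtain x x' where x: "x \<in> A" "x' \<in> A" "b = \<pi> x" "b' = \<pi> x'" by (auto simp: B_def)
      then show "dist (radial b) (radial b') \<le> \<rho> * dist b b'"
        using lip(2)[OF x(1,2)] radial_\<pi> height_pos radial_surface[OF A_surface] by simp
    qed (use \<rho> in simp)
    ultimately have A_le: "hausdorff_measure k A \<le> ennreal (\<rho> ^ k) * hausdorff_measure k B" by simp
    have B_le: "hausdorff_measure k B \<le> ennreal (\<rho> ^ k) * hausdorff_measure k A"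
      unfolding B_def using lip(1) \<rho> by (intro hausdorff_measure_lipschitz_image) auto
    have pow: "ennreal (\<rho> ^ k) * (ennreal (\<rho> ^ Suc k) * ennreal \<rho>) = ennreal (\<rho> ^ (2 * DIM('a)))"
    proof -
      have "\<rho> ^ k * (\<rho> ^ Suc k * \<rho>) = \<rho> ^ (2 * DIM('a))"
        by (simp add: dim k_def mult_2 power_add)
      then show ?thesis using \<rho> by (simp flip: ennreal_mult)
    qed
    have "hausdorff_measure k A \<le> ennreal (\<rho> ^ k) * (\<kappa> * ennreal (norm w) * (ennreal (\<rho> ^ Suc k) * emeasure lborel C))"
      using A_le C'_le unfolding flat by (meson mult_left_mono order_trans zero_le)
    also have "\<dots> = ennreal (\<rho> ^ k) * ennreal (\<rho> ^ Suc k) * \<kappa> * (ennreal (norm w) * emeasure lborel C)"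
      by (simp only: mult_ac)
    also have "\<dots> \<le> ennreal (\<rho> ^ k) * ennreal (\<rho> ^ Suc k) * \<kappa> * (ennreal \<rho> * emeasure cone_measure A)"
      by (intro mult_left_mono \<mu>_ge) simp
    also have "\<dots> = (ennreal (\<rho> ^ k) * (ennreal (\<rho> ^ Suc k) * ennreal \<rho>)) * (\<kappa> * emeasure cone_measure A)"
      by (simp only: mult_ac)
    finally have upper: "hausdorff_measure k A \<le> ennreal (\<rho> ^ (2 * DIM('a))) * (\<kappa> * emeasure cone_measure A)"
      unfolding pow .
    have "\<kappa> * emeasure cone_measure A \<le> \<kappa> * (ennreal (\<rho> * norm w) * (ennreal (\<rho> ^ Suc k) * emeasure lborel C'))"
      using \<mu>_le C_le by (meson mult_left_mono order_trans zero_le)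
    also have "\<dots> = ennreal (\<rho> ^ Suc k) * ennreal \<rho> * hausdorff_measure k B"
      unfolding flat using \<rho> by (simp add: ennreal_mult mult_ac)
    also have "\<dots> \<le> ennreal (\<rho> ^ Suc k) * ennreal \<rho> * (ennreal (\<rho> ^ k) * hausdorff_measure k A)"
      by (intro mult_left_mono B_le) simp
    also have "\<dots> = (ennreal (\<rho> ^ k) * (ennreal (\<rho> ^ Suc k) * ennreal \<rho>)) * hausdorff_measure k A"
      by (simp only: mult_ac)
    finally have "\<kappa> * emeasure cone_measure A \<le> ennreal (\<rho> ^ (2 * DIM('a))) * hausdorff_measure k A"
      unfolding pow .
    with upper show "hausdorff_measure k A \<le> ennreal (\<rho> ^ (2 * DIM('a))) * (\<kappa> * emeasure cone_measure A) \<and>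
       \<kappa> * emeasure cone_measure A \<le> ennreal (\<rho> ^ (2 * DIM('a))) * hausdorff_measure k A" ..
  qed
qed

text \<open>
  The cone formula for the whole surface. The density vanishes at the origin, the one point that
  \<open>radial\<close> does not take to the surface, because there \<open>radial x = 0\<close>.
\<close>

theorem hausdorff_measure_surface:
  assumes dim: "DIM('a) = Suc DIM('k::euclidean_space)"
  shows "hausdorff_measure DIM('k) surface = flat_ratio TYPE('k) * (\<integral>\<^sup>+x. cone_density x \<partial>lborel)"
proof -
  define \<mu> where "\<mu> = scale_measure (flat_ratio TYPE('k)) cone_measure"
  have \<mu>_eq: "emeasure \<mu> A = flat_ratio TYPE('k) * emeasure cone_measure A" for A
    by (simp add: \<mu>_def)
  have "hausdorff_measure DIM('k) surface = emeasure \<mu> surface"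
  proof (rule hausdorff_measure_eq_if_locally_comparable)
    show "sets \<mu> = sets borel" by (simp add: \<mu>_def cone_measure_def)
    show "emeasure \<mu> (space \<mu>) \<noteq> \<infinity>"
      using cone_measure_finite flat_ratio_finite[where 'k='k]
      by (auto simp: \<mu>_def space_scale_measure ennreal_mult_eq_top_iff)
    show "compact surface" by (rule surface_compact)
    fix \<rho> :: real assume \<rho>: "1 < \<rho>"
    \<comment> \<open>The root undoes the exponent in the local estimate.\<close>
    define \<rho>' where "\<rho>' = root (2 * DIM('a)) \<rho>"
    have "1 < \<rho>'" "\<rho>' ^ (2 * DIM('a)) = \<rho>"
      using \<rho> by (auto simp: \<rho>'_def real_root_pow_pos2)
    then show "\<exists>\<delta>>0. \<forall>p\<in>surface. \<forall>A\<in>sets borel. A \<subseteq> surface \<inter> ball p \<delta> \<longrightarrow>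
      hausdorff_measure DIM('k) A \<le> ennreal \<rho> * emeasure \<mu> A \<and>
      emeasure \<mu> A \<le> ennreal \<rho> * hausdorff_measure DIM('k) A"
      using hausdorff_measure_small_piece[OF dim, of \<rho>'] unfolding \<mu>_eq by metis
  qed
  also have "\<dots> = flat_ratio TYPE('k) * emeasure cone_measure surface"
    by (rule \<mu>_eq)
  also have "emeasure cone_measure surface = (\<integral>\<^sup>+x. cone_density x \<partial>lborel)"
  proof -
    have "cone_density x * indicator surface (radial x) = cone_density x" for x
    proof (cases "D x = 0")
      case True
      then have "radial x = 0" by (simp add: radial_def)
      then show ?thesis using linear_0[OF normal_linear] by (simp add: cone_density_def)
    next
      case False
      then have "radial x \<in> surface" by (simp add: surface_def radial_def D_scale)
      then show ?thesis by simp
    qed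
    then show ?thesis
      using emeasure_cone_measure[OF borel_compact[OF surface_compact]] by simp
  qed
  finally show ?thesis .
qed

lemma frontier_solid: "frontier {x. norm (D x) \<le> 1} = surface"
proof (intro equalityI subsetI)
  have closed: "closed {x. norm (D x) \<le> 1}"
    by (intro closed_Collect_le continuous_intros D_continuous)
  have opn: "open {x. norm (D x) < 1}"
    by (intro open_Collect_less continuous_intros D_continuous)
  show "x \<in> surface" if "x \<in> frontier {x. norm (D x) \<le> 1}" for x
  proof -
    have "norm (D x) \<le> 1" "x \<notin> interior {x. norm (D x) \<le> 1}"
      using that closed by (auto simp: frontier_def)
    moreover have "{x. norm (D x) < 1} \<subseteq> interior {x. norm (D x) \<le> 1}"
      by (rule interior_maximal[OF _ opn]) auto
    ultimately show ?thesis by (force simp: surface_def)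
  qed
  show "x \<in> frontier {x. norm (D x) \<le> 1}" if x: "x \<in> surface" for x
  proof -
    have "x \<notin> interior {x. norm (D x) \<le> 1}"
    proof
      assume "x \<in> interior {x. norm (D x) \<le> 1}"
      then obtain e where e: "0 < e" "ball x e \<subseteq> {x. norm (D x) \<le> 1}"
        using mem_interior by blast
      have "x \<noteq> 0" using x linear_0[OF lin] by (auto simp: surface_def)
      define t where "t = e / (2 * norm x)"
      have t: "0 < t" "t * norm x < e" using e(1) \<open>x \<noteq> 0\<close> by (auto simp: t_def)
      have "(1 + t) *\<^sub>R x \<in> ball x e"
        using t by (simp add: dist_norm scaleR_add_left)
      then have "norm (D ((1 + t) *\<^sub>R x)) \<le> 1" using e(2) by blast
      then show False using x t(1) by (simp add: D_scale surface_def)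
    qed
    then show ?thesis using x closed by (simp add: frontier_def surface_def)
  qed
qed

end

section \<open>The ratio as a mean over the unit ball\<close>

text \<open>
  Hausdorff measure of dimension \<open>CARD('n) - 1\<close> is compared with Lebesgue measure on a Euclidean space of
  that dimension, so an index type with one element fewer than \<open>'n\<close> is required. The maximum keeps the
  type nonempty when \<open>'n\<close> has one element.
\<close>

typedef ('n::finite) pred_index = "{..<max 1 (CARD('n) - 1)}"
  by (intro exI[of _ 0]) simp

instance pred_index :: (finite) finite
proof
  have "(UNIV :: 'a pred_index set) = Abs_pred_index ` {..<max 1 (CARD('a) - 1)}"
    by (rule type_definition.Abs_image[OF type_definition_pred_index, symmetric])
  then show "finite (UNIV :: 'a pred_index set)" by (metis finite_imageI finite_lessThan)
qed

lemma card_pred_index: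
  assumes "2 \<le> CARD('n::finite)"
  shows "CARD('n) = Suc CARD('n pred_index)"
proof -
  have "CARD('n pred_index) = card {..<max 1 (CARD('n) - 1)}"
    by (rule type_definition.card[OF type_definition_pred_index])
  with assms show ?thesis by simp
qed

definition diag :: "real ^ 'n \<Rightarrow> real ^ 'n \<Rightarrow> real ^ 'n" where
  "diag q x = (\<chi> i. q $ i * x $ i)"

lemma diag_nth [simp]: "diag q x $ i = q $ i * x $ i"
  by (simp add: diag_def)

lemma ellipsoid_eq: "ellipsoid q = {x. norm (diag q x) \<le> 1}"
proof -
  have "norm (diag q x) \<le> 1 \<longleftrightarrow> (\<Sum>i\<in>UNIV. (q $ i)\<^sup>2 * (x $ i)\<^sup>2) \<le> 1" for x
    by (simp add: norm_vec_def L2_set_def real_sqrt_le_1_iff power_mult_distrib)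
  then show ?thesis by (simp add: ellipsoid_def)
qed

lemma ellipsoid_map_diag:
  assumes "\<And>i. q $ i > 0"
  shows "ellipsoid_map (diag q)"
proof (rule ellipsoid_map.intro)
  show "linear (diag q)"
    by (rule linearI) (auto simp: vec_eq_iff algebra_simps)
  show "x \<bullet> diag q y = diag q x \<bullet> y" for x y
    by (simp add: inner_vec_def mult_ac)
  show "x = 0" if "diag q x = 0" for x
    using that assms by (auto simp: vec_eq_iff) (metis less_irrefl)
qed

lemma nn_integral_diag_substitution:
  fixes q :: "real ^ 'n"
  assumes q: "\<And>i. q $ i > 0" 
  shows "\<exists>J::real. 0 < J \<and> (\<forall>f\<in>borel_measurable borel.
    (\<integral>\<^sup>+x. f x \<partial>lborel) = ennreal J * (\<integral>\<^sup>+y. f (\<chi> i. y $ i / q $ i) \<partial>lborel))"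
proof -
  define c where "c j = 1 / (q \<bullet> j)" for j
  define T :: "real ^ 'n \<Rightarrow> real ^ 'n" where "T y = (\<chi> i. y $ i / q $ i)" for y
  define J where "J = (\<Prod>j\<in>(Basis :: (real ^ 'n) set). \<bar>c j\<bar>)"
  have qj: "q \<bullet> j \<noteq> 0" if "j \<in> Basis" for j
    using that q unfolding Basis_vec_def by (auto simp: inner_axis) (metis less_irrefl)
  then have c: "c j \<noteq> 0" if "j \<in> Basis" for j using that by (simp add: c_def)
  then have "0 < J" unfolding J_def by (intro prod_pos) auto
  have T_eq: "(\<lambda>x. 0 + (\<Sum>j\<in>Basis. (c j * (x \<bullet> j)) *\<^sub>R j)) = T"
  proof
    fix x :: "real ^ 'n"
    show "0 + (\<Sum>j\<in>Basis. (c j * (x \<bullet> j)) *\<^sub>R j) = T x"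
    proof (rule euclidean_eqI)
      fix b :: "real ^ 'n" assume b: "b \<in> Basis"
      then obtain i where i: "b = axis i 1" by (auto simp: Basis_vec_def)
      show "(0 + (\<Sum>j\<in>Basis. (c j * (x \<bullet> j)) *\<^sub>R j)) \<bullet> b = T x \<bullet> b"
      proof -
        have "(0 + (\<Sum>j\<in>Basis. (c j * (x \<bullet> j)) *\<^sub>R j)) \<bullet> b = c b * (x \<bullet> b)"
          using b by simp
        then show ?thesis by (simp add: c_def i T_def inner_axis)
      qed
    qed
  qed
  have T_meas [measurable]: "T \<in> borel_measurable borel"
    unfolding T_eq[symmetric] by measurable
  show ?thesis
  proof (intro exI[of _ J] conjI ballI \<open>0 < J\<close>)
    fix f :: "real ^ 'n \<Rightarrow> ennreal" assume [measurable]: "f \<in> borel_measurable borel"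
    have "(\<integral>\<^sup>+x. f x \<partial>lborel) = (\<integral>\<^sup>+x. f x \<partial>density (distr lborel borel T) (\<lambda>_. ennreal J))"
      using lborel_affine_euclidean[of c 0, OF c] unfolding T_eq J_def by simp
    also have "\<dots> = ennreal J * (\<integral>\<^sup>+y. f (T y) \<partial>lborel)"
      by (simp add: nn_integral_density nn_integral_distr nn_integral_cmult)
    finally show "(\<integral>\<^sup>+x. f x \<partial>lborel) = ennreal J * (\<integral>\<^sup>+y. f (\<chi> i. y $ i / q $ i) \<partial>lborel)"
      by (simp add: T_def)
  qed
qed

text \<open>
  Proportional to the mean length of \<open>diag q u\<close> over unit vectors \<open>u\<close>; integrating over the ball,
  where \<open>sgn y = y / norm y\<close>, avoids a measure on the sphere.
\<close>

definition mean_stretch :: "real ^ 'n \<Rightarrow> real" where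
  "mean_stretch q = (\<integral>y. indicator (cball 0 1) y * norm (diag q (sgn y)) \<partial>lborel)"

lemma diag_measurable [measurable]: "diag q \<in> borel_measurable borel"
proof -
  have "linear (diag q)" by (rule linearI) (auto simp: vec_eq_iff algebra_simps)
  then show ?thesis
    by (intro borel_measurable_continuous_onI linear_continuous_on) (simp add: linear_conv_bounded_linear)
qed

lemma sgn_measurable [measurable]: "sgn \<in> borel_measurable (borel :: 'a::euclidean_space measure)"
  unfolding sgn_div_norm[abs_def] by measurable

lemma integrable_stretch: "integrable lborel (\<lambda>y. indicator (cball 0 1) y * norm (diag q (sgn y)) :: real)"
proof (rule integrableI_bounded_set)
  show "emeasure lborel (cball 0 1 :: (real ^ 'n) set) < \<infinity>"
    by (rule emeasure_bounded_finite) simp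
  have "norm (diag q (sgn y)) \<le> (\<Sum>i\<in>UNIV. \<bar>q $ i\<bar>)" for y
  proof -
    have "norm (diag q (sgn y)) \<le> (\<Sum>i\<in>UNIV. \<bar>diag q (sgn y) $ i\<bar>)" by (rule norm_le_l1_cart)
    also have "\<dots> \<le> (\<Sum>i\<in>UNIV. \<bar>q $ i\<bar>)"
    proof (rule sum_mono)
      fix i
      have "\<bar>sgn y $ i\<bar> \<le> 1"
        using component_le_norm_cart[of "sgn y" i] norm_sgn[of y] by (auto split: if_splits)
      then show "\<bar>diag q (sgn y) $ i\<bar> \<le> \<bar>q $ i\<bar>" by (simp add: abs_mult mult_left_le)
    qed
    finally show ?thesis .
  qed
  then show "AE y in lborel. y \<in> cball 0 1 \<longrightarrow>
      norm (indicator (cball 0 1) y * norm (diag q (sgn y)) :: real) \<le> (\<Sum>i\<in>UNIV. \<bar>q $ i\<bar>)"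
    by (simp add: indicator_def)
qed (auto simp: indicator_def)

text \<open>
  If \<open>q $ i\<close> is nonzero, then the integrand vanishes only on the hyperplane \<open>y $ i = 0\<close>, a null set, whereas
  the ball has positive volume.
\<close>

lemma mean_stretch_eq_0D:
  fixes q :: "real ^ 'n"
  assumes "mean_stretch q = 0"
  shows "q = 0"
proof (rule ccontr)
  assume "q \<noteq> 0"
  then obtain i where i: "q $ i \<noteq> 0" by (auto simp: vec_eq_iff)
  have "AE y in lborel. indicator (cball 0 1) y * norm (diag q (sgn y)) = (0::real)"
    using assms integrable_stretch[of q] unfolding mean_stretch_def
    by (subst (asm) integral_nonneg_eq_0_iff_AE) auto
  moreover have "AE y in lborel. (y :: real ^ 'n) \<notin> {y. y $ i = 0}"
  proof (rule AE_not_in)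
    have "closed {y :: real ^ 'n. y $ i = 0}"
      by (intro closed_Collect_eq continuous_intros)
    then have "{y :: real ^ 'n. y $ i = 0} \<in> sets lborel" by simp
    moreover have "{y :: real ^ 'n. y $ i = 0} \<in> null_sets lebesgue"
      using negligible_standard_hyperplane_cart[of i] by (simp add: negligible_iff_null_sets)
    ultimately show "{y :: real ^ 'n. y $ i = 0} \<in> null_sets lborel"
      by (simp add: null_sets_completion_iff)
  qed
  ultimately have "AE y in lborel. (y :: real ^ 'n) \<notin> cball 0 1"
  proof eventually_elim
    case (elim y)
    show ?case
    proof
      assume "y \<in> cball 0 1"
      with elim(1) have "diag q (sgn y) = 0" by simp
      then have "diag q (sgn y) $ i = 0" by simp
      then have "y = 0 \<or> y $ i = 0" using i by (auto simp: sgn_div_norm)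
      with elim(2) show False by auto
    qed
  qed
  then have "emeasure lborel (cball 0 1 :: (real ^ 'n) set) = 0"
    by (subst (asm) AE_iff_measurable[of "cball 0 1"]) auto
  moreover have "0 < unit_ball_vol (real CARD('n))"
    by (rule unit_ball_vol_pos) simp
  ultimately show False by (simp add: emeasure_cball del: unit_ball_vol_pos)
qed

lemma is_norm_mean_stretch: "is_norm (mean_stretch :: real ^ 'n \<Rightarrow> real)"
  unfolding is_norm_def
proof (intro conjI allI)
  fix p q :: "real ^ 'n" and a :: real
  show "0 \<le> mean_stretch q"
    unfolding mean_stretch_def by (intro integral_nonneg_AE) auto
  show "mean_stretch (a *\<^sub>R q) = \<bar>a\<bar> * mean_stretch q"
  proof -
    have "diag (a *\<^sub>R q) y = a *\<^sub>R diag q y" for y by (simp add: vec_eq_iff)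
    then show ?thesis
      unfolding mean_stretch_def by (simp add: mult.left_commute)
  qed
  show "mean_stretch (p + q) \<le> mean_stretch p + mean_stretch q"
  proof -
    have "diag (p + q) y = diag p y + diag q y" for y by (simp add: vec_eq_iff algebra_simps)
    then have "mean_stretch (p + q) \<le> (\<integral>y. indicator (cball 0 1) y * norm (diag p (sgn y)) +
        indicator (cball 0 1) y * norm (diag q (sgn y)) \<partial>lborel)"
      unfolding mean_stretch_def
      by (intro integral_mono integrable_stretch Bochner_Integration.integrable_add)
         (use integrable_stretch[of "p + q"] in \<open>auto simp: indicator_def norm_triangle_ineq\<close>)
    also have "\<dots> = mean_stretch p + mean_stretch q"
      unfolding mean_stretch_def by (intro Bochner_Integration.integral_add integrable_stretch)
    finally show ?thesis .
  qed
  show "(mean_stretch q = 0) = (q = 0)"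
  proof
    assume "q = 0"
    then have "diag q y = 0" for y by (simp add: vec_eq_iff)
    then show "mean_stretch q = 0" by (simp add: mean_stretch_def)
  qed (rule mean_stretch_eq_0D)
qed

text \<open>
  Under \<open>x = diag q\<inverse> y\<close> the density of the cone measure becomes \<open>norm (diag q (sgn y))\<close> on the
  unit ball, and the Jacobian \<open>J\<close> cancels against the one in the volume.
\<close>

theorem surface_volume_ratio_eq_mean_stretch:
  fixes q :: "real ^ 'n"
  assumes n: "2 \<le> CARD('n)" and q: "\<And>i. q $ i > 0"
  shows "surface_volume_ratio q = flat_ratio TYPE(real ^ ('n pred_index)) *
    ennreal (mean_stretch q) / emeasure lborel (cball 0 1 :: (real ^ 'n) set)"
proof -
  interpret ellipsoid_map "diag q" by (rule ellipsoid_map_diag[OF q])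
  define \<kappa> where "\<kappa> = flat_ratio TYPE(real ^ ('n pred_index))"
  have card: "CARD('n) = Suc CARD('n pred_index)" by (rule card_pred_index[OF n])
  obtain J :: real where J: "0 < J"
    "\<And>f. f \<in> borel_measurable borel \<Longrightarrow>
      (\<integral>\<^sup>+x. f x \<partial>lborel) = ennreal J * (\<integral>\<^sup>+y. f (\<chi> i. y $ i / q $ i) \<partial>lborel)"
    using nn_integral_diag_substitution[of q, OF q] by blast
  have inverse: "diag q (\<chi> i. y $ i / q $ i) = y" for y
    using q by (simp add: vec_eq_iff) (metis less_irrefl)
  have "hausdorff_measure (CARD('n) - 1) (frontier (ellipsoid q)) = \<kappa> * (\<integral>\<^sup>+x. cone_density x \<partial>lborel)"
    using hausdorff_measure_surface[where 'k="real ^ ('n pred_index)"] card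
    by (simp add: ellipsoid_eq frontier_solid \<kappa>_def)
  also have "(\<integral>\<^sup>+x. cone_density x \<partial>lborel) = ennreal J * (\<integral>\<^sup>+y. cone_density (\<chi> i. y $ i / q $ i) \<partial>lborel)"
    by (rule J(2)) measurable
  also have "(\<integral>\<^sup>+y. cone_density (\<chi> i. y $ i / q $ i) \<partial>lborel) =
      (\<integral>\<^sup>+y. ennreal (indicator (cball 0 1) y * norm (diag q (sgn y))) \<partial>lborel)"
  proof (rule nn_integral_cong)
    fix y :: "real ^ 'n"
    have "normal (radial (\<chi> i. y $ i / q $ i)) = diag q (sgn y)"
      unfolding normal_def radial_def D_scale inverse sgn_div_norm by (simp add: D_scale divide_inverse)
    then show "cone_density (\<chi> i. y $ i / q $ i) = ennreal (indicator (cball 0 1) y * norm (diag q (sgn y)))"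
      by (simp add: cone_density_def inverse indicator_def)
  qed
  also have "\<dots> = ennreal (mean_stretch q)"
    unfolding mean_stretch_def by (rule nn_integral_eq_integral[OF integrable_stretch]) auto
  finally have area: "hausdorff_measure (CARD('n) - 1) (frontier (ellipsoid q)) =
      \<kappa> * (ennreal J * ennreal (mean_stretch q))" .
  have "emeasure lborel (ellipsoid q) = (\<integral>\<^sup>+x. indicator (ellipsoid q) x \<partial>lborel)"
    by (rule nn_integral_indicator[symmetric]) (simp add: ellipsoid_eq)
  also have "\<dots> = ennreal J * (\<integral>\<^sup>+y. indicator (ellipsoid q) (\<chi> i. y $ i / q $ i) \<partial>lborel)"
    by (rule J(2)) (simp add: ellipsoid_eq)
  also have "(\<integral>\<^sup>+y. indicator (ellipsoid q) (\<chi> i. y $ i / q $ i) \<partial>lborel) =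
      (\<integral>\<^sup>+y. indicator (cball 0 1 :: (real ^ 'n) set) y \<partial>lborel)"
    by (intro nn_integral_cong) (simp add: ellipsoid_eq indicator_def inverse)
  finally have volume: "emeasure lborel (ellipsoid q) = ennreal J * emeasure lborel (cball 0 1 :: (real ^ 'n) set)"
    by simp
  have "surface_volume_ratio q = (ennreal J * (\<kappa> * ennreal (mean_stretch q))) /
      (ennreal J * emeasure lborel (cball 0 1 :: (real ^ 'n) set))"
    unfolding surface_volume_ratio_def area volume by (simp only: mult.left_commute)
  also have "\<dots> = \<kappa> * ennreal (mean_stretch q) / emeasure lborel (cball 0 1 :: (real ^ 'n) set)"
    unfolding mult.commute[of "ennreal J"] using J(1) by (intro divide_mult_eq) auto
  finally show ?thesis unfolding \<kappa>_def .
qed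

theorem theorem1:
  assumes "CARD('n::finite) \<ge> 2"
  shows "\<exists>N :: real ^ 'n \<Rightarrow> real. is_norm N \<and>
           (\<forall>q. (\<forall>i. q $ i > 0) \<longrightarrow> surface_volume_ratio q = ennreal (N q))"
proof -
  obtain c where c: "0 < c" "flat_ratio TYPE(real ^ ('n pred_index)) = ennreal c"
    using flat_ratio_finite[where 'k="real ^ ('n pred_index)"] flat_ratio_pos[where 'k="real ^ ('n pred_index)"]
    by (cases "flat_ratio TYPE(real ^ ('n pred_index))") auto
  define \<omega> where "\<omega> = unit_ball_vol (real CARD('n))"
  have \<omega>: "0 < \<omega>" unfolding \<omega>_def by (rule unit_ball_vol_pos) simp
  define N :: "real ^ 'n \<Rightarrow> real" where "N q = c / \<omega> * mean_stretch q" for q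
  have "is_norm N"
  proof -
    define r where "r = c / \<omega>"
    have r: "0 < r" using c \<omega> by (simp add: r_def)
    then have "r * mean_stretch (x + y) \<le> r * mean_stretch x + r * mean_stretch y" for x y :: "real ^ 'n"
      using is_norm_mean_stretch[where 'n='n] unfolding is_norm_def by (simp flip: distrib_left)
    then show ?thesis
      using is_norm_mean_stretch[where 'n='n] r unfolding is_norm_def N_def r_def[symmetric]
      by (simp add: mult.left_commute)
  qed
  moreover have "surface_volume_ratio q = ennreal (N q)" if q: "\<forall>i. q $ i > 0" for q :: "real ^ 'n"
  proof -
    have "0 \<le> mean_stretch q" using is_norm_mean_stretch by (auto simp: is_norm_def)
    then show ?thesis
      using surface_volume_ratio_eq_mean_stretch[OF assms, of q] q c \<omega>
      by (simp add: N_def emeasure_cball \<omega>_def[symmetric] divide_ennreal flip: ennreal_mult)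
  qed
  ultimately show ?thesis by blast
qed

end
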